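(* Let $p$ be a prime and let $G$ be a metabelian $p$-group of order $p^n$ and of maximal class. \begin{enumerate} \item If $n=3$, then $\mathcal{CD}(G)=\{Z(G),A,A_1,\dots,A_p,G\}$ is a quasi-antichain of width $p+1$, for some abelian subgroups $A,A_1,\dots,A_p$ of $G$. \item If $G$ possesses an abelian subgroup $A$ with $|G:A|=p$ and $n>3$, then $\mathcal{CD}(G)=\{A\}$. \item Suppose that $G$ does not possess an abelian subgroup of index $p$. Then $n>4$, and furthermore: \begin{enumerate} \item If $|G|=p^5$, then $\mathcal{CD}(G)=\{Z(G),Z(T),G',A_1,\dots,A_p,T,G\}$ for some subgroups $T,A_1,\dots,A_p$ of $G$ with $|T|=p^4$, $|G'|=|A_i|=p^3$ for each $i$, $|Z(T)|=p^2$, and $G',A_1,\dots,A_p$ all abelian and pairwise distinct; moreover none of $A_1,\dots,A_p$ is normal in $G$. \item If $|G|>p^5$ and $G$ possesses a subgroup $T$ of index $p$ with $|T:Z(T)|=p^2$, then $\mathcal{CD}(G)=\{Z(T),G',A_1,\dots,A_p,T\}$ for some subgroups $A_1,\dots,A_p$ of $G$, where $|T|=p^{n-1}$, $|G'|=|A_i|=p^{n-2}$ for each $i$, $|Z(T)|=p^{n-3}$, and $G',A_1,\dots,A_p$ are all abelian and pairwise distinct; moreover none of $A_1,\dots,A_p$ is normal in $G$. \item If $|G|>p^5$ and $G$ does not possess a subgroup $T$ of index $p$ with $|T:Z(T)|=p^2$, then $\mathcal{CD}(G)=\{G'\}$. \end{enumerate} \end{enumerate}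
   Context: A finite group $G$ is metabelian if its derived subgroup $G'$ is abelian. A $p$-group of order $p^n$ is of maximal class if its nilpotency class is $n-1$. For a finite group $G$ and $H\le G$, $m_G(H)=|H|\,|C_G(H)|$, $m^*(G)=\max\{m_G(H)\mid H\le G\}$, and the Chermak-Delgado lattice is $\mathcal{CD}(G)=\{H\le G\mid m_G(H)=m^*(G)\}$. A lattice is a quasi-antichain of width $w$ if it consists of a least element, a greatest element, and $w$ further pairwise incomparable elements. *)

theory Defs
  imports "HOL-Algebra.Algebra"
begin

definition centralizer :: "('a, 'b) monoid_scheme \<Rightarrow> 'a set \<Rightarrow> 'a set" where
  "centralizer G H = {g \<in> carrier G. \<forall>h \<in> H. g \<otimes>\<^bsub>G\<^esub> h = h \<otimes>\<^bsub>G\<^esub> g}"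

definition grp_center :: "('a, 'b) monoid_scheme \<Rightarrow> 'a set \<Rightarrow> 'a set" where
  "grp_center G H = H \<inter> centralizer G H"

definition abelian_subgroup :: "('a, 'b) monoid_scheme \<Rightarrow> 'a set \<Rightarrow> bool" where
  "abelian_subgroup G H \<longleftrightarrow> subgroup H G \<and> (\<forall>x \<in> H. \<forall>y \<in> H. x \<otimes>\<^bsub>G\<^esub> y = y \<otimes>\<^bsub>G\<^esub> x)"

definition commutator_subgroup :: "('a, 'b) monoid_scheme \<Rightarrow> 'a set \<Rightarrow> 'a set \<Rightarrow> 'a set" where
  "commutator_subgroup G H K = generate G
     (\<Union>h \<in> H. \<Union>k \<in> K. {h \<otimes>\<^bsub>G\<^esub> k \<otimes>\<^bsub>G\<^esub> inv\<^bsub>G\<^esub> h \<otimes>\<^bsub>G\<^esub> inv\<^bsub>G\<^esub> k})"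

(* lower central series: gamma_1 = G (index 0 here), gamma_{i+1} = [gamma_i, G] *)
fun lower_central :: "('a, 'b) monoid_scheme \<Rightarrow> nat \<Rightarrow> 'a set" where
  "lower_central G 0 = carrier G"
| "lower_central G (Suc i) = commutator_subgroup G (lower_central G i) (carrier G)"

definition nilpotent :: "('a, 'b) monoid_scheme \<Rightarrow> bool" where
  "nilpotent G \<longleftrightarrow> (\<exists>c. lower_central G c = {\<one>\<^bsub>G\<^esub>})"

definition nilpotency_class :: "('a, 'b) monoid_scheme \<Rightarrow> nat" where
  "nilpotency_class G = (LEAST c. lower_central G c = {\<one>\<^bsub>G\<^esub>})"

definition metabelian :: "('a, 'b) monoid_scheme \<Rightarrow> bool" where
  "metabelian G \<longleftrightarrow> abelian_subgroup G (derived G (carrier G))"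

definition maximal_class_pgroup :: "('a, 'b) monoid_scheme \<Rightarrow> nat \<Rightarrow> nat \<Rightarrow> bool" where
  "maximal_class_pgroup G p n \<longleftrightarrow> group G \<and> finite (carrier G) \<and> Factorial_Ring.prime p \<and>
     order G = p ^ n \<and> nilpotent G \<and> nilpotency_class G + 1 = n"

definition mG :: "('a, 'b) monoid_scheme \<Rightarrow> 'a set \<Rightarrow> nat" where
  "mG G H = card H * card (centralizer G H)"

definition m_star :: "('a, 'b) monoid_scheme \<Rightarrow> nat" where
  "m_star G = Max {mG G H | H. subgroup H G}"

definition CD :: "('a, 'b) monoid_scheme \<Rightarrow> 'a set set" where
  "CD G = {H. subgroup H G \<and> mG G H = m_star G}"

definition quasi_antichain :: "'a set set \<Rightarrow> nat \<Rightarrow> bool" where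
  "quasi_antichain Ls w \<longleftrightarrow> (\<exists>Bt Tp Ms.
     Ls = {Bt, Tp} \<union> Ms \<and> Bt \<noteq> Tp \<and> Bt \<notin> Ms \<and> Tp \<notin> Ms \<and>
     finite Ms \<and> card Ms = w \<and>
     (\<forall>S1. S1 \<in> Ls \<longrightarrow> Bt \<subseteq> S1 \<and> S1 \<subseteq> Tp) \<and>
     (\<forall>S1 S2. S1 \<in> Ms \<and> S2 \<in> Ms \<and> S1 \<subseteq> S2 \<longrightarrow> S1 = S2))"

end

theory Submission
  imports Defs
begin

text \<open>
  Let \<open>L i\<close> be the lower central series, so \<open>L 1 = G'\<close>, and suppose that no abelian subgroup has
  index \<open>p\<close>. Then \<open>G'\<close> is its own centralizer, and every \<open>h\<close> outside \<open>G'\<close> centralizes at most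
  \<open>q = |L 2|\<close> elements of \<open>G'\<close>, with equality only if it centralizes exactly \<open>L 2\<close> there, because
  \<open>L 2\<close> is the only normal subgroup of \<open>G\<close> of index \<open>p\<close> in \<open>G'\<close>. Distinguishing whether \<open>H\<close>
  and \<open>C\<^sub>G(H)\<close> lie in \<open>G'\<close>, this bounds \<open>|H| |C\<^sub>G(H)|\<close> by \<open>|G'|\<^sup>2\<close>, and the equality cases are
  governed by the single candidate \<open>T = C\<^sub>G(L 2)\<close>: if \<open>T\<close> is larger than \<open>G'\<close> then \<open>Z(T) = L 2\<close>
  and the \<open>p + 1\<close> subgroups strictly between \<open>Z(T)\<close> and \<open>T\<close> are abelian, \<open>G'\<close> being the only
  normal one. For order \<open>p\<^sup>5\<close> the inequality \<open>T \<noteq> G'\<close> is automatic, since a conjugacy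
  class in \<open>L 2\<close> has at most \<open>p\<close> elements.
\<close>

section \<open>Commuting modulo a normal subgroup\<close>

text \<open>Quotients of \<open>G\<close> never appear as groups. A statement about G/N is phrased
  through \<open>cmod N S\<close>, the elements that commute with \<open>S\<close> up to
  \<open>N\<close>, so a central section, an abelian quotient or a step of the lower central series
  becomes an inclusion between subgroups of \<open>G\<close>. The class hypothesis enters through
  the length of that series: with exactly n-1 strict steps and a first step of index at least p^2,
  all orders are forced, and these orders drive every later count. Without an abelian subgroup of
  index p, the value to beat is m(G') = |G'|^2 = p^(2n-4), whereas m(G) = m(Z(G)) = p^(n+1). The two
  agree exactly at n = 5, which is why \<open>G\<close> and its centre survive only there. The
  delicate case is that neither \<open>H\<close> nor its centralizer lies in G': the product formula
  in \<open>G\<close> is then too weak by a factor p for each of them, and applying it inside a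
  proper subgroup that contains G' recovers that factor.\<close>

lemma card_le_fibres:
  assumes "finite A" "finite B" "f ` A \<subseteq> B"
    and "\<And>a. a \<in> A \<Longrightarrow> card {x \<in> A. f x = f a} \<le> k"
  shows "card A \<le> card B * k"
proof -
  have fib: "card {x \<in> A. f x = b} \<le> k" for b
  proof (cases "{x \<in> A. f x = b} = {}")
    case False
    then obtain a where "a \<in> A" "f a = b" by blast
    then show ?thesis using assms(4)[of a] by simp
  qed (metis card.empty zero_le)
  have "card A = (\<Sum>b\<in>B. card {x \<in> A. f x = b})"
    using sum_fun_comp[OF assms(1,2,3), of "\<lambda>_. 1::nat"] by simp
  also have "\<dots> \<le> (\<Sum>b\<in>B. k)"
    by (rule sum_mono) (rule fib)
  finally show ?thesis by simp
qed

context group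
begin

abbreviation comm :: "'a \<Rightarrow> 'a \<Rightarrow> 'a"
  where "comm a b \<equiv> a \<otimes> b \<otimes> inv a \<otimes> inv b"

text \<open>For normal \<open>N\<close> this is the preimage in \<open>G\<close> of the centralizer
  of the image of \<open>S\<close> in G/N. With \<open>N = {\<one>}\<close> it is the ordinary
  centralizer, so one set of lemmas serves both.\<close>

definition cmod :: "'a set \<Rightarrow> 'a set \<Rightarrow> 'a set"
  where "cmod N S = {g \<in> carrier G. \<forall>x\<in>S. comm g x \<in> N}"

lemma inv_cancel: "x \<in> carrier G \<Longrightarrow> y \<in> carrier G \<Longrightarrow> x \<otimes> (inv x \<otimes> y) = y"
  by (simp add: m_assoc[symmetric])

lemma inv_cancel': "x \<in> carrier G \<Longrightarrow> y \<in> carrier G \<Longrightarrow> inv x \<otimes> (x \<otimes> y) = y"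
  by (simp add: m_assoc[symmetric])

text \<open>These rules bring a word in elements and inverses to freely reduced form, which lets
  \<open>simp\<close> settle the commutator identities below.\<close>

lemmas free_reduce = m_assoc inv_mult_group inv_cancel inv_cancel'

lemma comm_eq_one_iff:
  assumes "a \<in> carrier G" "b \<in> carrier G"
  shows "comm a b = \<one> \<longleftrightarrow> a \<otimes> b = b \<otimes> a"
proof
  assume "comm a b = \<one>"
  then have "comm a b \<otimes> (b \<otimes> a) = b \<otimes> a" using assms by simp
  then show "a \<otimes> b = b \<otimes> a" using assms by (simp add: free_reduce)
qed (use assms in \<open>simp add: free_reduce\<close>)

lemma comm_closed_normal:
  assumes N: "N \<lhd> G" and "n \<in> N" "g \<in> carrier G"
  shows "comm n g \<in> N" "comm g n \<in> N"
proof -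
  have s: "subgroup N G" using N normal_imp_subgroup by blast
  have n: "n \<in> carrier G" using s assms by (meson subgroup.mem_carrier)
  have "g \<otimes> inv n \<otimes> inv g \<in> N" "g \<otimes> n \<otimes> inv g \<in> N"
    using N assms s by (auto simp: normal_inv_iff subgroup.m_inv_closed)
  then have "n \<otimes> (g \<otimes> inv n \<otimes> inv g) \<in> N" "(g \<otimes> n \<otimes> inv g) \<otimes> inv n \<in> N"
    using s assms by (auto simp: subgroup.m_closed subgroup.m_inv_closed)
  then show "comm n g \<in> N" "comm g n \<in> N" using n assms by (simp_all add: m_assoc)
qed

lemma cmod_subset: "cmod N S \<subseteq> carrier G"
  by (auto simp: cmod_def)

text \<open>Closure rests on [ab,x] = (a[b,x]a^-1)[a,x] and [a^-1,x] = a^-1 [a,x]^-1 a: normality of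
  \<open>N\<close> keeps the conjugates inside \<open>N\<close>.\<close>

lemma subgroup_cmod:
  assumes N: "N \<lhd> G" and S: "S \<subseteq> carrier G"
  shows "subgroup (cmod N S) G"
proof -
  have s: "subgroup N G" using N normal_imp_subgroup by blast
  have conj: "g \<otimes> n \<otimes> inv g \<in> N" if "g \<in> carrier G" "n \<in> N" for g n
    using N that by (simp add: normal_inv_iff)
  show ?thesis
  proof (rule subgroupI)
    have "\<one> \<in> cmod N S"
      using S s subgroup.one_closed[OF s] by (auto simp: cmod_def subset_iff)
    then show "cmod N S \<noteq> {}" by blast
  next
    fix a assume a: "a \<in> cmod N S"
    then have ac: "a \<in> carrier G" by (simp add: cmod_def)
    have "comm (inv a) x \<in> N" if x: "x \<in> S" for x
    proof -
      have xc: "x \<in> carrier G" using x S by blast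
      have "inv (comm a x) \<in> N" using a x s by (auto simp: cmod_def subgroup.m_inv_closed)
      from conj[OF inv_closed[OF ac] this] show ?thesis
        using ac xc by (simp add: free_reduce)
    qed
    then show "inv a \<in> cmod N S" using ac by (simp add: cmod_def)
  next
    fix a b assume a: "a \<in> cmod N S" and b: "b \<in> cmod N S"
    then have ac: "a \<in> carrier G" and bc: "b \<in> carrier G" by (auto simp: cmod_def)
    have "comm (a \<otimes> b) x \<in> N" if x: "x \<in> S" for x
    proof -
      have xc: "x \<in> carrier G" using x S by blast
      have ax: "comm a x \<in> N" and bx: "comm b x \<in> N" using a b x by (auto simp: cmod_def)
      have "(a \<otimes> comm b x \<otimes> inv a) \<otimes> comm a x \<in> N"
        using subgroup.m_closed[OF s conj[OF ac bx] ax] .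
      then show ?thesis using ac bc xc by (simp add: free_reduce)
    qed
    then show "a \<otimes> b \<in> cmod N S" using ac bc by (simp add: cmod_def)
  qed (rule cmod_subset)
qed

lemma cmod_sym:
  assumes "subgroup N G" "S \<subseteq> carrier G" "R \<subseteq> carrier G" "S \<subseteq> cmod N R"
  shows "R \<subseteq> cmod N S"
proof
  fix y assume y: "y \<in> R"
  have "comm y x \<in> N" if x: "x \<in> S" for x
  proof -
    have "inv (comm x y) \<in> N"
      using assms x y by (auto simp: cmod_def subgroup.m_inv_closed)
    moreover have "x \<in> carrier G" "y \<in> carrier G" using assms x y by auto
    ultimately show ?thesis by (simp add: free_reduce)
  qed
  then show "y \<in> cmod N S" using y assms by (auto simp: cmod_def)
qed

text \<open>The bridge between the lower central series and \<open>cmod\<close>: only the generating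
  commutators have to be tested.\<close>

lemma commutator_subgroup_le_iff:
  assumes "subgroup N G" "H \<subseteq> carrier G"
  shows "commutator_subgroup G H K \<subseteq> N \<longleftrightarrow> H \<subseteq> cmod N K"
proof -
  let ?U = "\<Union>h \<in> H. \<Union>k \<in> K. {comm h k}"
  have "commutator_subgroup G H K \<subseteq> N \<longleftrightarrow> ?U \<subseteq> N"
    unfolding commutator_subgroup_def
    using generate_subgroup_incl[OF _ assms(1), of ?U] generate.incl[of _ ?U G] by blast
  also have "\<dots> \<longleftrightarrow> H \<subseteq> cmod N K" using assms by (auto simp: cmod_def)
  finally show ?thesis .
qed

lemma centralizer_eq_cmod: "S \<subseteq> carrier G \<Longrightarrow> centralizer G S = cmod {\<one>} S"
  unfolding centralizer_def cmod_def by (auto simp: comm_eq_one_iff subset_iff)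

lemma subgroup_centralizer: "S \<subseteq> carrier G \<Longrightarrow> subgroup (centralizer G S) G"
  by (simp add: centralizer_eq_cmod subgroup_cmod one_is_normal)

lemma centralizer_sym:
  "S \<subseteq> carrier G \<Longrightarrow> R \<subseteq> carrier G \<Longrightarrow> S \<subseteq> centralizer G R \<longleftrightarrow> R \<subseteq> centralizer G S"
  unfolding centralizer_def subset_iff by auto

lemma centralizer_mono: "S \<subseteq> R \<Longrightarrow> centralizer G R \<subseteq> centralizer G S"
  by (auto simp: centralizer_def)

lemma abelian_subgroup_iff:
  "abelian_subgroup G H \<longleftrightarrow> subgroup H G \<and> H \<subseteq> centralizer G H"
  unfolding abelian_subgroup_def centralizer_def subset_iff mem_Collect_eq
  by (meson subgroup.mem_carrier)

text \<open>The generated subgroup is brought in on one side at a time, with \<open>cmod_sym\<close>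
  exchanging the sides in between.\<close>

lemma generate_cmod:
  assumes N: "N \<lhd> G" and S: "S \<subseteq> carrier G" and "S \<subseteq> cmod N S"
  shows "generate G S \<subseteq> cmod N (generate G S)"
proof -
  have s: "subgroup N G" using N normal_imp_subgroup by blast
  have gc: "generate G S \<subseteq> carrier G" using S by (rule generate_incl)
  have "generate G S \<subseteq> cmod N S"
    using generate_subgroup_incl[OF assms(3) subgroup_cmod[OF N S]] .
  then have "S \<subseteq> cmod N (generate G S)" using cmod_sym[OF s gc S] by blast
  then show ?thesis using generate_subgroup_incl subgroup_cmod[OF N gc] by blast
qed

lemma abelian_generate:
  assumes "S \<subseteq> carrier G" "S \<subseteq> centralizer G S"
  shows "abelian_subgroup G (generate G S)"
  using generate_cmod[OF one_is_normal assms(1)] assms generate_incl[OF assms(1)]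
  by (simp add: abelian_subgroup_iff generate_is_subgroup centralizer_eq_cmod)

section \<open>Divisibility of orders, subgroups of prime index, and counting by fibres\<close>

lemma card_subgroup_dvd:
  assumes "subgroup H G" "subgroup K G" "H \<subseteq> K" "finite (carrier G)"
  shows "card H dvd card K"
proof -
  interpret K: group "G\<lparr>carrier := K\<rparr>" using subgroup.subgroup_is_group[OF assms(2)] is_group by blast
  have K_simp: "carrier (G\<lparr>carrier := K\<rparr>) = K" by simp
  have "subgroup H (G\<lparr>carrier := K\<rparr>)" using assms subgroup_incl by blast
  then have "card (rcosets\<^bsub>G\<lparr>carrier := K\<rparr>\<^esub> H) * card H = order (G\<lparr>carrier := K\<rparr>)" by (rule K.lagrange)
  then show ?thesis unfolding order_def by (metis (no_types) K_simp dvd_triv_right)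
qed

lemma prime_index_between:
  assumes "subgroup H G" "subgroup T G" "subgroup K G" "H \<subseteq> K" "K \<subseteq> T" "finite (carrier G)"
    and "Factorial_Ring.prime (p::nat)" "card T = p * card H"
  shows "K = H \<or> K = T"
proof -
  have fin: "finite T" "finite K"
    using assms(2,3,6) by (auto intro: finite_subset dest: subgroup.subset)
  have "card H > 0" using assms by (simp add: subgroup.finite_imp_card_positive)
  obtain a where a: "card K = card H * a"
    using card_subgroup_dvd[OF assms(1,3,4,6)] by blast
  obtain b where b: "card T = card K * b"
    using card_subgroup_dvd[OF assms(3,2,5,6)] by blast
  have "card H * p = card H * (a * b)" using a b assms(8) by (metis mult.assoc mult.commute)
  then have "p = a * b" using \<open>card H > 0\<close> by simp
  then have "a = 1 \<or> b = 1" using assms(7) by (metis prime_product)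
  then show ?thesis
  proof
    assume "a = 1"
    then show ?thesis using a fin assms(4) by (metis card_subset_eq mult.right_neutral)
  next
    assume "b = 1"
    then show ?thesis using b fin assms(5) by (metis card_subset_eq mult.right_neutral)
  qed
qed

text \<open>Modulo \<open>N\<close>, the subgroup \<open>M\<close> is central with cyclic quotient.\<close>

lemma prime_index_central_mod:
  assumes N: "N \<lhd> G" and M: "subgroup M G" and T: "subgroup T G" and "M \<subseteq> T" "finite (carrier G)"
    and p: "Factorial_Ring.prime (p::nat)" and idx: "card T = p * card M" and cen: "M \<subseteq> cmod N T"
  shows "T \<subseteq> cmod N T"
proof -
  have s: "subgroup N G" using N normal_imp_subgroup by blast
  have Tc: "T \<subseteq> carrier G" using T by (rule subgroup.subset)
  have "M \<noteq> T"
  proof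
    assume "M = T"
    moreover have "card T > 0" using T assms(5) by (simp add: subgroup.finite_imp_card_positive)
    ultimately show False using idx prime_gt_1_nat[OF p] by (metis mult_cancel2 nat_mult_1 nat_neq_iff)
  qed
  then obtain x where x: "x \<in> T" "x \<notin> M" using assms(4) by blast
  let ?S = "insert x M"
  have XT: "?S \<subseteq> T" using x assms(4) by blast
  have Xc: "?S \<subseteq> carrier G" using XT Tc by blast
  have gen: "generate G ?S = T"
  proof -
    have "generate G ?S \<subseteq> T" using generate_subgroup_incl[OF XT T] .
    moreover have "M \<subseteq> generate G ?S" "x \<in> generate G ?S" by (auto intro: generate.incl)
    ultimately have "generate G ?S = M \<or> generate G ?S = T"
      using prime_index_between[OF M T generate_is_subgroup[OF Xc] _ _ assms(5) p idx] by simp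
    then show ?thesis using x \<open>x \<in> generate G ?S\<close> by auto
  qed
  have "M \<subseteq> cmod N ?S" using cen XT by (auto simp: cmod_def)
  moreover have "x \<in> cmod N ?S"
  proof -
    have "T \<subseteq> cmod N M" using cmod_sym[OF s subgroup.subset[OF M] Tc cen] .
    then have "comm x m \<in> N" if "m \<in> M" for m using x that by (auto simp: cmod_def)
    moreover have "comm x x \<in> N" using x Xc subgroup.one_closed[OF s] by (simp add: free_reduce)
    ultimately show ?thesis using Xc by (auto simp: cmod_def)
  qed
  ultimately have "?S \<subseteq> cmod N ?S" by blast
  from generate_cmod[OF N Xc this] gen show ?thesis by simp
qed

lemma prime_index_central_abelian:
  assumes "subgroup M G" "subgroup T G" "M \<subseteq> T" "finite (carrier G)"
    and "Factorial_Ring.prime (p::nat)" "card T = p * card M" "M \<subseteq> centralizer G T"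
  shows "abelian_subgroup G T"
  using prime_index_central_mod[OF one_is_normal assms(1-6)] assms
  by (simp add: abelian_subgroup_iff centralizer_eq_cmod subgroup.subset)

text \<open>The fibre of (h,k) -> hk through a given pair consists of pairs (hd, d^-1 k) with d in
  the intersection, and all products stay in \<open>T\<close>. The ambient \<open>T\<close> is kept
  free because a \<open>T\<close> smaller than \<open>G\<close> gives a sharper bound.\<close>

lemma card_product_bound:
  assumes "subgroup H G" "subgroup K G" "subgroup T G" "H \<subseteq> T" "K \<subseteq> T" "finite (carrier G)"
  shows "card H * card K \<le> card T * card (H \<inter> K)"
proof -
  have fin: "finite H" "finite K" "finite T"
    using assms(1,2,3,6) by (auto intro: finite_subset dest: subgroup.subset)
  have Hc: "H \<subseteq> carrier G" and Kc: "K \<subseteq> carrier G" using assms by (simp_all add: subgroup.subset)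
  have "card (H \<times> K) \<le> card T * card (H \<inter> K)"
  proof (rule card_le_fibres[where f = "\<lambda>(h,k). h \<otimes> k"])
    show "(\<lambda>(h,k). h \<otimes> k) ` (H \<times> K) \<subseteq> T" using assms by (auto intro: subgroup.m_closed[OF assms(3)])
    fix a assume "a \<in> H \<times> K"
    then obtain h k where a: "a = (h,k)" "h \<in> H" "k \<in> K" by blast
    have hk: "h \<in> carrier G" "k \<in> carrier G" using a Hc Kc by auto
    let ?F = "{x \<in> H \<times> K. (\<lambda>(h,k). h \<otimes> k) x = (\<lambda>(h,k). h \<otimes> k) a}"
    have "?F \<subseteq> (\<lambda>d. (h \<otimes> d, inv d \<otimes> k)) ` (H \<inter> K)"
    proof
      fix x assume "x \<in> ?F"
      then obtain h' k' where x: "x = (h',k')" "h' \<in> H" "k' \<in> K" "h' \<otimes> k' = h \<otimes> k" using a by auto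
      have hk': "h' \<in> carrier G" "k' \<in> carrier G" using x Hc Kc by auto
      let ?d = "inv h \<otimes> h'"
      have "inv h \<otimes> (h' \<otimes> k') \<otimes> inv k' = inv h \<otimes> (h \<otimes> k) \<otimes> inv k'" using x by simp
      then have d: "?d = k \<otimes> inv k'" using hk hk' by (simp add: free_reduce)
      have "?d \<in> H" using a x assms(1) by (simp add: subgroup.m_closed subgroup.m_inv_closed)
      moreover have "?d \<in> K" unfolding d using a x assms(2) by (simp add: subgroup.m_closed subgroup.m_inv_closed)
      moreover have "h \<otimes> ?d = h'" using hk hk' by (simp add: free_reduce)
      moreover have "inv ?d \<otimes> k = k'" unfolding d using hk hk' by (simp add: free_reduce)
      ultimately show "x \<in> (\<lambda>d. (h \<otimes> d, inv d \<otimes> k)) ` (H \<inter> K)" using x by force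
    qed
    moreover have "finite (H \<inter> K)" using fin by simp
    ultimately show "card ?F \<le> card (H \<inter> K)" by (rule surj_card_le[rotated])
  qed (use fin in auto)
  then show ?thesis by (simp add: card_cartesian_product)
qed

text \<open>If [x,u] = [a,u], then a^-1 x centralizes u. So each fibre of g -> [g,u] lies in one
  coset of the centralizer, and there are at most |N| fibres.\<close>

lemma card_centralizer_bound:
  assumes "finite (carrier G)" "N \<subseteq> carrier G" "u \<in> carrier G" "\<And>g. g \<in> carrier G \<Longrightarrow> comm g u \<in> N"
  shows "order G \<le> card N * card (centralizer G {u})"
  unfolding order_def
proof (rule card_le_fibres[where f = "\<lambda>g. comm g u"])
  fix a assume a: "a \<in> carrier G"
  let ?F = "{x \<in> carrier G. comm x u = comm a u}"
  have "?F \<subseteq> (\<lambda>c. a \<otimes> c) ` centralizer G {u}"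
  proof
    fix x assume "x \<in> ?F"
    then have x: "x \<in> carrier G" "comm x u = comm a u" by auto
    have "comm x u \<otimes> u = comm a u \<otimes> u" using x by simp
    then have eq: "x \<otimes> u \<otimes> inv x = a \<otimes> u \<otimes> inv a"
      using x(1) a assms(3) by (simp add: m_assoc)
    have "(inv a \<otimes> x) \<otimes> u = inv a \<otimes> (x \<otimes> u \<otimes> inv x) \<otimes> x" using x a assms(3) by (simp add: free_reduce)
    also have "\<dots> = u \<otimes> (inv a \<otimes> x)" unfolding eq using x a assms(3) by (simp add: free_reduce)
    finally have "inv a \<otimes> x \<in> centralizer G {u}" using x a by (simp add: centralizer_def)
    moreover have "x = a \<otimes> (inv a \<otimes> x)" using x a by (simp add: free_reduce)
    ultimately show "x \<in> (\<lambda>c. a \<otimes> c) ` centralizer G {u}" by blast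
  qed
  moreover have "finite (centralizer G {u})" using assms(1) by (simp add: centralizer_def)
  ultimately show "card ?F \<le> card (centralizer G {u})" by (rule surj_card_le[rotated])
qed (use assms in \<open>auto intro: finite_subset\<close>)

end

section \<open>Nilpotent groups and intermediate subgroups\<close>

lemma prime_power_div_eq:
  assumes "Factorial_Ring.prime (p::nat)" "m dvd p ^ 2" "m \<noteq> 1" "m \<noteq> p ^ 2"
  shows "m = p"
proof -
  obtain i where "i \<le> 2" "m = p ^ i" using assms(1,2) by (auto simp: divides_primepow_nat)
  moreover have "i \<noteq> 0" "i \<noteq> 2" using calculation assms by auto
  ultimately have "i = 1" by linarith
  then show ?thesis using \<open>m = p ^ i\<close> by simp
qed

context group
begin

lemma normal_if_cmod:
  assumes "subgroup H G" "H \<subseteq> cmod H (carrier G)"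
  shows "H \<lhd> G"
  unfolding normal_inv_iff
proof (intro conjI assms ballI)
  fix g h assume g: "g \<in> carrier G" and h: "h \<in> H"
  have hc: "h \<in> carrier G" using assms(1) h by (rule subgroup.mem_carrier)
  have "comm h g \<in> H" using assms(2) g h by (auto simp: cmod_def)
  then have "inv (inv h \<otimes> comm h g) \<in> H"
    using assms(1) h by (simp add: subgroup.m_closed subgroup.m_inv_closed)
  then show "g \<otimes> h \<otimes> inv g \<in> H" using g hc by (simp add: free_reduce)
qed

lemma normal_cmod: "N \<lhd> G \<Longrightarrow> N \<subseteq> cmod N (carrier G)"
  using subgroup.subset[OF normal_imp_subgroup] by (auto simp: cmod_def comm_closed_normal)

lemma commutator_subgroup_normal:
  assumes "M \<lhd> G"
  shows "commutator_subgroup G M (carrier G) \<lhd> G" "commutator_subgroup G M (carrier G) \<subseteq> M"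
    "M \<subseteq> cmod (commutator_subgroup G M (carrier G)) (carrier G)"
proof -
  let ?K = "commutator_subgroup G M (carrier G)"
  have M: "subgroup M G" using assms normal_imp_subgroup by blast
  then have Mc: "M \<subseteq> carrier G" by (rule subgroup.subset)
  show KM: "?K \<subseteq> M" using commutator_subgroup_le_iff[OF M Mc] normal_cmod[OF assms] by blast
  have K: "subgroup ?K G" unfolding commutator_subgroup_def
    by (rule generate_is_subgroup) (use Mc in auto)
  show MK: "M \<subseteq> cmod ?K (carrier G)" using commutator_subgroup_le_iff[OF K Mc] by blast
  show "?K \<lhd> G" by (rule normal_if_cmod[OF K]) (use KM MK in blast)
qed

section \<open>The lower central series through commutation modulo its terms\<close>

lemma carrier_normal: "carrier G \<lhd> G"
  by (rule normal_if_cmod[OF subgroup_self]) (auto simp: cmod_def)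

lemma lower_central_normal: "lower_central G i \<lhd> G"
  by (induction i) (auto simp: carrier_normal commutator_subgroup_normal)

lemma subgroup_lower_central: "subgroup (lower_central G i) G"
  using lower_central_normal normal_imp_subgroup by blast

lemma lower_central_subset: "lower_central G i \<subseteq> carrier G"
  using subgroup_lower_central by (rule subgroup.subset)

lemma lower_central_Suc_subset: "lower_central G (Suc i) \<subseteq> lower_central G i"
  by (simp add: commutator_subgroup_normal lower_central_normal)

lemma lower_central_antimono: "i \<le> j \<Longrightarrow> lower_central G j \<subseteq> lower_central G i"
  by (rule lift_Suc_antimono_le[of "lower_central G", OF lower_central_Suc_subset])

lemma lower_central_Suc_le_iff:
  "subgroup N G \<Longrightarrow> lower_central G (Suc i) \<subseteq> N \<longleftrightarrow> lower_central G i \<subseteq> cmod N (carrier G)"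
  using commutator_subgroup_le_iff lower_central_subset by simp

lemma lower_central_cmod:
  "lower_central G i \<subseteq> cmod (lower_central G (Suc i)) (carrier G)"
  using lower_central_Suc_le_iff[OF subgroup_lower_central] by blast

lemma derived_eq_lower_central: "derived G (carrier G) = lower_central G 1"
  by (simp add: derived_def commutator_subgroup_def)

lemma derived_le_iff:
  "subgroup N G \<Longrightarrow> derived G (carrier G) \<subseteq> N \<longleftrightarrow> carrier G \<subseteq> cmod N (carrier G)"
  using lower_central_Suc_le_iff[of N 0] by (simp add: derived_eq_lower_central)

lemma lower_central_2_le_iff:
  "subgroup N G \<Longrightarrow> lower_central G 2 \<subseteq> N \<longleftrightarrow> derived G (carrier G) \<subseteq> cmod N (carrier G)"
  using lower_central_Suc_le_iff[of N 1] by (simp add: derived_eq_lower_central numeral_2_eq_2)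

declare lower_central.simps(2) [simp del]

text \<open>The series runs from \<open>G\<close> down to 1, so at some index its intersection with
  \<open>M\<close> drops into \<open>N\<close>. An element of the layer just above has commutators
  with \<open>G\<close> in the next layer; this supplies central elements modulo \<open>N\<close>
  without an upper central series.\<close>

lemma nilpotent_last_layer:
  assumes "nilpotent G" "\<one> \<in> N" "M \<subseteq> carrier G" "\<not> M \<subseteq> N"
  obtains i where "\<not> M \<inter> lower_central G i \<subseteq> N" "M \<inter> lower_central G (Suc i) \<subseteq> N"
proof -
  have "\<exists>i. \<not> M \<inter> lower_central G i \<subseteq> N \<and> M \<inter> lower_central G (Suc i) \<subseteq> N"
  proof (rule ccontr)
    assume contra: "\<not> ?thesis"
    obtain c where c: "lower_central G c = {\<one>}" using assms(1) by (auto simp: nilpotent_def)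
    have "\<not> M \<inter> lower_central G i \<subseteq> N" for i
    proof (induction i)
      case 0
      show ?case using assms(3,4) by auto
    next
      case (Suc i)
      then show ?case using contra by blast
    qed
    from this[of c] show False using assms(2) c by auto
  qed
  then show ?thesis using that by blast
qed

text \<open>In a nilpotent group, a nontrivial normal subgroup of the quotient by \<open>N\<close>
  meets the centre of that quotient. Since M/N has prime order, meeting the centre means lying in
  it.\<close>

lemma nilpotent_prime_section_central:
  assumes "nilpotent G" "finite (carrier G)" and N: "N \<lhd> G" and M: "M \<lhd> G" and "N \<subseteq> M"
    and p: "Factorial_Ring.prime (p::nat)" "card M = p * card N"
  shows "M \<subseteq> cmod N (carrier G)"
proof (cases "M \<subseteq> N")
  case True
  then show ?thesis using normal_cmod[OF N] by blast
next
  case False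
  have sN: "subgroup N G" and sM: "subgroup M G" using N M normal_imp_subgroup by blast+
  obtain i where i: "\<not> M \<inter> lower_central G i \<subseteq> N" "M \<inter> lower_central G (Suc i) \<subseteq> N"
    using nilpotent_last_layer[OF assms(1) subgroup.one_closed[OF sN] subgroup.subset[OF sM] False] .
  then obtain x where x: "x \<in> M" "x \<in> lower_central G i" "x \<notin> N" by blast
  have "comm x g \<in> N" if g: "g \<in> carrier G" for g
  proof -
    have "comm x g \<in> M" using comm_closed_normal(1)[OF M x(1) g] .
    moreover have "comm x g \<in> lower_central G (Suc i)"
      using lower_central_cmod[of i] x g unfolding cmod_def by blast
    ultimately show ?thesis using i by blast
  qed
  then have xc: "x \<in> cmod N (carrier G)"
    using x sM subgroup.mem_carrier by (fastforce simp: cmod_def)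
  let ?K = "M \<inter> cmod N (carrier G)"
  have "subgroup ?K G" using sM subgroup_cmod[OF N] by (simp add: subgroups_Inter_pair)
  moreover have "N \<subseteq> ?K" using assms(5) normal_cmod[OF N] by blast
  ultimately have "?K = N \<or> ?K = M"
    using prime_index_between[OF sN sM _ _ _ assms(2) p] by blast
  then show ?thesis using x xc by blast
qed

text \<open>Let \<open>x\<close> lie in the last term of the series that is not inside
  \<open>T\<close>. It normalizes \<open>T\<close>, so maximality makes \<open>T\<close> normal. The
  same \<open>x\<close> is central modulo \<open>T\<close>, so maximality applied once more makes
  the quotient by \<open>T\<close> abelian.\<close>

lemma nilpotent_maximal_contains_derived:
  assumes "nilpotent G" and T: "subgroup T G" "T \<noteq> carrier G"
    and max: "\<And>K. subgroup K G \<Longrightarrow> T \<subseteq> K \<Longrightarrow> K = T \<or> K = carrier G"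
  shows "derived G (carrier G) \<subseteq> T"
proof -
  have Tc: "T \<subseteq> carrier G" using T by (simp add: subgroup.subset)
  then have "\<not> carrier G \<subseteq> T" using T by blast
  then obtain i where i: "\<not> carrier G \<inter> lower_central G i \<subseteq> T" "carrier G \<inter> lower_central G (Suc i) \<subseteq> T"
    using nilpotent_last_layer[OF assms(1) subgroup.one_closed[OF T(1)] subset_refl] by blast
  have LT: "lower_central G (Suc i) \<subseteq> T" using i(2) lower_central_subset by blast
  obtain x where x: "x \<in> lower_central G i" "x \<notin> T" using i(1) by blast
  have commT: "comm y g \<in> T" if "y \<in> lower_central G i" "g \<in> carrier G" for y g
    using lower_central_cmod[of i] LT that unfolding cmod_def by blast
  have xc: "x \<in> carrier G" using x lower_central_subset by blast
  \<comment> \<open>The normalizer of \<open>T\<close>, with conjugation required in both directions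
    so that closure under inverses is immediate.\<close>
  let ?K = "{g \<in> carrier G. \<forall>t\<in>T. g \<otimes> t \<otimes> inv g \<in> T \<and> inv g \<otimes> t \<otimes> g \<in> T}"
  have K: "subgroup ?K G"
  proof (rule subgroupI)
    have "\<one> \<in> ?K" using Tc by (auto simp: subset_iff)
    then show "?K \<noteq> {}" by blast
  next
    fix a b assume a: "a \<in> ?K" and b: "b \<in> ?K"
    have "(a \<otimes> b) \<otimes> t \<otimes> inv (a \<otimes> b) \<in> T \<and> inv (a \<otimes> b) \<otimes> t \<otimes> (a \<otimes> b) \<in> T" if t: "t \<in> T" for t
    proof -
      have "a \<otimes> (b \<otimes> t \<otimes> inv b) \<otimes> inv a \<in> T" "inv b \<otimes> (inv a \<otimes> t \<otimes> a) \<otimes> b \<in> T"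
        using a b t by blast+
      moreover have "t \<in> carrier G" using t Tc by blast
      ultimately show ?thesis using a b by (simp add: m_assoc inv_mult_group)
    qed
    then show "a \<otimes> b \<in> ?K" using a b by simp
  qed auto
  have TK: "T \<subseteq> ?K" using Tc T(1) by (auto simp: subgroup.m_closed subgroup.m_inv_closed)
  have "x \<otimes> t \<otimes> inv x \<in> T \<and> inv x \<otimes> t \<otimes> x \<in> T" if t: "t \<in> T" for t
  proof -
    have tc: "t \<in> carrier G" using t Tc by blast
    have "inv x \<in> lower_central G i" using subgroup.m_inv_closed[OF subgroup_lower_central x(1)] .
    then have "comm x t \<otimes> t \<in> T" "comm (inv x) t \<otimes> t \<in> T"
      using commT[OF _ tc] x(1) t T(1) by (simp_all add: subgroup.m_closed)
    then show ?thesis using xc tc by (simp add: free_reduce)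
  qed
  then have "x \<in> ?K" using xc by blast
  then have "?K = carrier G" using max[OF K TK] x by blast
  then have N: "T \<lhd> G" unfolding normal_inv_iff using T(1) by blast
  have "x \<in> cmod T (carrier G)" using commT x(1) xc by (simp add: cmod_def)
  then have "cmod T (carrier G) = carrier G"
    using max[OF subgroup_cmod[OF N subset_refl] normal_cmod[OF N]] x by blast
  then show ?thesis using derived_le_iff[OF T(1)] by simp
qed

lemma nilpotent_proper_subgroup:
  assumes "nilpotent G" "finite (carrier G)" "subgroup H G" "H \<noteq> carrier G"
  obtains T where "subgroup T G" "T \<noteq> carrier G" "H \<subseteq> T" "derived G (carrier G) \<subseteq> T"
proof -
  let ?A = "{K. subgroup K G \<and> K \<noteq> carrier G}"
  have "?A \<subseteq> Pow (carrier G)" using subgroup.subset by blast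
  then have "finite ?A" using assms(2) by (simp add: finite_subset)
  moreover have "H \<in> ?A" using assms by simp
  ultimately obtain T where T: "T \<in> ?A" "H \<subseteq> T" "\<forall>K\<in>?A. T \<subseteq> K \<longrightarrow> T = K"
    using finite_has_maximal2[of ?A H] by auto
  have "derived G (carrier G) \<subseteq> T"
    by (rule nilpotent_maximal_contains_derived[OF assms(1)]) (use T in auto)
  then show ?thesis using that[of T] T by simp
qed

text \<open>An element outside the central subgroup \<open>K\<close> generates with \<open>K\<close>
  an abelian group, which cannot be the nonabelian \<open>T\<close> and so has order p|K|. Hence T -
  K is partitioned by the sets H - K, each of size (p-1)|K|, and their number is (p^2-1)/(p-1) =
  p+1.\<close>

lemma card_intermediate_subgroups:
  assumes fin: "finite (carrier G)" and p: "Factorial_Ring.prime (p::nat)"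
    and K: "subgroup K G" and T: "subgroup T G" and KT: "K \<subseteq> T" and cen: "K \<subseteq> centralizer G T"
    and nab: "\<not> abelian_subgroup G T" and card: "card T = p ^ 2 * card K"
  defines "I \<equiv> {H. subgroup H G \<and> K \<subseteq> H \<and> H \<subseteq> T \<and> card H = p * card K}"
  shows "finite I" "card I = p + 1" "\<And>H. H \<in> I \<Longrightarrow> abelian_subgroup G H"
proof -
  have Tc: "T \<subseteq> carrier G" using T by (rule subgroup.subset)
  have finT: "finite T" using Tc fin by (rule finite_subset)
  have cK: "card K > 0" using K fin by (simp add: subgroup.finite_imp_card_positive)
  have p1: "p > 1" using p by (rule prime_gt_1_nat)
  show finI: "finite I" by (rule finite_subset[of _ "Pow T"]) (auto simp: I_def finT)
  show "abelian_subgroup G H" if "H \<in> I" for H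
  proof -
    have "K \<subseteq> centralizer G H" using cen that centralizer_mono[of H T] by (auto simp: I_def)
    then show ?thesis
      using prime_index_central_abelian[OF K _ _ fin p] that by (simp add: I_def)
  qed
  have ex: "\<exists>H\<in>I. x \<in> H \<and> (\<forall>H'\<in>I. x \<in> H' \<longrightarrow> H' = H)" if x: "x \<in> T" "x \<notin> K" for x
  proof -
    let ?S = "insert x K"
    let ?B = "generate G ?S"
    have ST: "?S \<subseteq> T" using x KT by blast
    then have Sc: "?S \<subseteq> carrier G" using Tc by blast
    have "K \<subseteq> centralizer G ?S" using cen centralizer_mono[OF ST] by blast
    moreover have "x \<in> centralizer G ?S"
      using cen x Sc by (auto simp: centralizer_def subset_iff)
    ultimately have ab: "abelian_subgroup G ?B" using abelian_generate[OF Sc] by blast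
    have B: "subgroup ?B G" using generate_is_subgroup[OF Sc] .
    have BT: "?B \<subseteq> T" using generate_subgroup_incl[OF ST T] .
    have KB: "K \<subseteq> ?B" and xB: "x \<in> ?B" by (auto intro: generate.incl)
    obtain m where m: "card ?B = card K * m" using card_subgroup_dvd[OF K B KB fin] by blast
    have "card ?B dvd card T" using card_subgroup_dvd[OF B T BT fin] .
    then have "card K * m dvd card K * p ^ 2" unfolding card m by (simp add: mult.commute)
    then have "m dvd p ^ 2" using cK by simp
    moreover have "m \<noteq> 1"
    proof
      assume "m = 1"
      then have "card K = card ?B" using m by simp
      then have "K = ?B" using card_subset_eq[OF finite_subset[OF BT finT] KB] by blast
      then show False using x xB by blast
    qed
    moreover have "m \<noteq> p ^ 2"
    proof
      assume "m = p ^ 2"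
      then have "card ?B = card T" using m card by (simp add: mult.commute)
      then have "?B = T" using card_subset_eq[OF finT BT] by blast
      then show False using ab nab by simp
    qed
    ultimately have "m = p" using prime_power_div_eq[OF p] by blast
    then have cB: "card ?B = p * card K" using m by (simp add: mult.commute)
    then have "?B \<in> I" using B BT KB by (simp add: I_def)
    moreover have "H' = ?B" if "H' \<in> I" "x \<in> H'" for H'
    proof -
      have H': "subgroup H' G" "K \<subseteq> H'" "H' \<subseteq> T" "card H' = p * card K" using that by (auto simp: I_def)
      have "?S \<subseteq> H'" using H' that by blast
      then have "?B \<subseteq> H'" using generate_subgroup_incl H'(1) by blast
      moreover have "finite H'" using H'(3) finT by (rule finite_subset)
      ultimately show ?thesis using card_subset_eq[of H' ?B] cB H'(4) by simp
    qed
    ultimately show ?thesis using xB by blast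
  qed
  have un: "T - K = (\<Union>H\<in>I. H - K)"
  proof
    show "T - K \<subseteq> (\<Union>H\<in>I. H - K)" using ex by blast
  qed (auto simp: I_def)
  have cd: "card (H - K) = (p - 1) * card K" if "H \<in> I" for H
  proof -
    have "K \<subseteq> H" "card H = p * card K" using that by (auto simp: I_def)
    moreover have "finite K" using KT finT by (rule finite_subset)
    ultimately show ?thesis by (simp add: card_Diff_subset diff_mult_distrib)
  qed
  have "card (T - K) = (\<Sum>H\<in>I. card (H - K))"
    unfolding un
  proof (rule card_UN_disjoint[OF finI])
    show "\<forall>H\<in>I. finite (H - K)" using finT by (auto simp: I_def intro: finite_subset)
    show "\<forall>H\<in>I. \<forall>H'\<in>I. H \<noteq> H' \<longrightarrow> (H - K) \<inter> (H' - K) = {}"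
    proof (intro ballI impI equals0I)
      fix H H' x assume h: "H \<in> I" "H' \<in> I" "H \<noteq> H'" "x \<in> (H - K) \<inter> (H' - K)"
      then have "x \<in> T" "x \<notin> K" by (auto simp: I_def)
      then show False using ex h by blast
    qed
  qed
  then have "card (T - K) = card I * ((p - 1) * card K)" using cd by simp
  moreover have "card (T - K) = (p ^ 2 - 1) * card K"
    using card KT finT by (simp add: card_Diff_subset finite_subset[OF KT finT] diff_mult_distrib)
  moreover have "p ^ 2 - 1 = (p + 1) * (p - 1)"
    using p1 by (cases p) (auto simp: power2_eq_square)
  ultimately have "(p + 1) * (p - 1) * card K = card I * (p - 1) * card K" by (simp add: mult.assoc)
  then show "card I = p + 1" using cK p1 by (metis mult_cancel2 nat_neq_iff zero_less_diff)
qed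

end

section \<open>Structure of groups of maximal class\<close>

locale maximal_class = group G for G :: "('a, 'b) monoid_scheme" (structure) +
  fixes p n :: nat
  assumes mc: "maximal_class_pgroup G p n"
begin

abbreviation "L \<equiv> lower_central G"
abbreviation "Z \<equiv> grp_center G (carrier G)"
abbreviation "C \<equiv> centralizer G"

lemma fin: "finite (carrier G)" and prime_p: "Factorial_Ring.prime p"
  and card_G: "card (carrier G) = p ^ n" and nilp: "nilpotent G"
  and class_eq: "nilpotency_class G + 1 = n"
  using mc by (simp_all add: maximal_class_pgroup_def order_def)

lemma p_gt_1: "p > 1"
  using prime_p by (rule prime_gt_1_nat)

lemma finite_subgroup: "subgroup H G \<Longrightarrow> finite H"
  using fin by (auto intro: finite_subset dest: subgroup.subset)

lemma card_subgroup: "subgroup H G \<Longrightarrow> \<exists>k\<le>n. card H = p ^ k"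
  using card_subgroup_dvd[OF _ subgroup_self _ fin] subgroup.subset
  by (metis card_G divides_primepow_nat prime_p)

lemma card_pos: "subgroup H G \<Longrightarrow> card H > 0"
  using fin by (simp add: subgroup.finite_imp_card_positive)

lemma card_proper_subgroup:
  assumes "subgroup H G" "subgroup K G" "H \<subset> K"
  shows "p * card H \<le> card K"
proof -
  obtain a b where ab: "card H = p ^ a" "card K = p ^ b"
    using card_subgroup assms by meson
  have "card H < card K" using finite_subgroup[OF assms(2)] assms(3) by (rule psubset_card_mono)
  then have "a < b" using ab p_gt_1 by simp
  then have "p ^ Suc a \<le> p ^ b" using p_gt_1 by (intro power_increasing) auto
  then show ?thesis using ab by simp
qed

lemma subgroup_eqI:
  assumes "subgroup H G" "subgroup K G" "H \<subseteq> K" "card K \<le> card H"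
  shows "H = K"
  using card_seteq[OF finite_subgroup[OF assms(2)] assms(3,4)] .

lemma L_last: "L (n - 1) = {\<one>}"
proof -
  have "L (nilpotency_class G) = {\<one>}"
    using nilp unfolding nilpotent_def nilpotency_class_def by (rule LeastI_ex)
  moreover have "nilpotency_class G = n - 1" using class_eq by simp
  ultimately show ?thesis by simp
qed

lemma L_trivial_imp: "L i = {\<one>} \<Longrightarrow> n - 1 \<le> i"
proof -
  assume "L i = {\<one>}"
  then have "nilpotency_class G \<le> i" unfolding nilpotency_class_def by (rule Least_le)
  then show ?thesis using class_eq by simp
qed

lemma n_ge_2: "n \<ge> 2"
proof (rule ccontr)
  assume "\<not> ?thesis"
  then have "n = 1" using class_eq by simp
  then have "carrier G = {\<one>}" using L_last by simp
  then have "card (carrier G) = 1" by simp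
  then show False using card_G p_gt_1 \<open>n = 1\<close> by simp
qed

text \<open>Once one step of the series is stationary, all later ones are too, so the series would
  stall before it reaches 1 at index n-1.\<close>

lemma L_strict:
  assumes "i < n - 1"
  shows "\<not> L i \<subseteq> L (Suc i)"
proof
  assume sub: "L i \<subseteq> L (Suc i)"
  have "L i \<subseteq> L (i + k)" for k
  proof (induction k)
    case (Suc k)
    have "L i \<subseteq> cmod (L (Suc (i + k))) (carrier G)"
      using Suc lower_central_cmod[of "i + k"] by blast
    then have "L (Suc i) \<subseteq> L (Suc (i + k))"
      using lower_central_Suc_le_iff[OF subgroup_lower_central] by blast
    then show ?case using sub by simp
  qed simp
  from this[of "n - 1 - i"] have "L i \<subseteq> {\<one>}" using assms L_last by simp
  then have "L i = {\<one>}" using subgroup.one_closed[OF subgroup_lower_central[of i]] by blast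
  then show False using L_trivial_imp assms by fastforce
qed

lemma L_card_step: "i < n - 1 \<Longrightarrow> p * card (L (Suc i)) \<le> card (L i)"
  using L_strict lower_central_Suc_subset
  by (intro card_proper_subgroup subgroup_lower_central) blast

abbreviation "Der \<equiv> derived G (carrier G)"

lemma subgroup_Der: "subgroup Der G"
  by (simp add: derived_is_subgroup)

lemma Der_subset: "Der \<subseteq> carrier G"
  using subgroup_Der by (rule subgroup.subset)

lemma L2_subset_Der: "L 2 \<subseteq> Der"
  using lower_central_antimono[of 1 2] by (simp add: derived_eq_lower_central)

text \<open>Otherwise \<open>G / L 2\<close> would be abelian, contradicting the strict descent of the series.\<close>

lemma not_central_mod_L2:
  assumes "n \<ge> 3" "subgroup M G" "M \<subseteq> cmod (L 2) (carrier G)"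
  shows "p * card M < p ^ n"
proof (rule ccontr)
  assume "\<not> ?thesis"
  then have ge: "p ^ n \<le> p * card M" by simp
  have Mc: "M \<subseteq> carrier G" using assms(2) by (rule subgroup.subset)
  have "carrier G \<subseteq> cmod (L 2) (carrier G)"
  proof (cases "M = carrier G")
    case False
    then have "p * card M \<le> card (carrier G)"
      using card_proper_subgroup[OF assms(2) subgroup_self] Mc by blast
    then have "card (carrier G) = p * card M" using ge card_G by simp
    then show ?thesis
      using prime_index_central_mod[OF lower_central_normal assms(2) subgroup_self Mc fin prime_p _ assms(3)]
      by blast
  qed (use assms in simp)
  then have "L 1 \<subseteq> L (Suc 1)"
    using derived_le_iff[OF subgroup_lower_central[of 2]]
    by (simp add: derived_eq_lower_central numeral_2_eq_2)
  moreover have "1 < n - 1" using assms(1) by linarith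
  ultimately show False using L_strict[of 1] by blast
qed

text \<open>\<open>L 1\<close> is central modulo \<open>L 2\<close>, so it cannot have index p or 1
  in \<open>G\<close>; as orders are powers of p, the index is at least p^2.\<close>

lemma card_L1_le: "p ^ 2 * card (L 1) \<le> p ^ n"
proof (cases "n = 2")
  case True
  then have "L 1 = {\<one>}" using L_last by simp
  then show ?thesis using True by simp
next
  case False
  then have n: "n \<ge> 3" using n_ge_2 by simp
  have "L 1 \<subseteq> cmod (L 2) (carrier G)"
    using lower_central_cmod[of 1] by (simp add: numeral_2_eq_2)
  then have "p * card (L 1) < p ^ n"
    using not_central_mod_L2[OF n subgroup_lower_central] by blast
  moreover obtain k where k: "card (L 1) = p ^ k" using card_subgroup subgroup_lower_central by blast
  ultimately have "p ^ Suc k < p ^ n" by simp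
  then have "Suc k < n" using p_gt_1 by (metis power_less_imp_less_exp)
  then have "p ^ (2 + k) \<le> p ^ n" using p_gt_1 by (intro power_increasing) auto
  then show ?thesis using k by (simp add: power_add power2_eq_square mult.assoc)
qed

lemma pow_split: "k \<le> m \<Longrightarrow> p ^ m = p ^ k * p ^ (m - k)"
  by (simp flip: power_add)

text \<open>A squeeze: going down from \<open>L 1\<close>, of index at least p^2, each step costs at
  least a factor p; going up from the trivial term, each step gains at least a factor p. The n-1
  steps leave no slack.\<close>

lemma card_L:
  assumes "1 \<le> i" "i < n"
  shows "card (L i) = p ^ (n - 1 - i)"
proof (rule antisym)
  have "p ^ (i + 1) * card (L i) \<le> p ^ n" using assms
  proof (induction i rule: nat_induct_at_least)
    case base
    then show ?case using card_L1_le by (simp add: numeral_2_eq_2)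
  next
    case (Suc i)
    have "p ^ (Suc i + 1) * card (L (Suc i)) = p ^ (i + 1) * (p * card (L (Suc i)))"
      by simp
    also have "\<dots> \<le> p ^ (i + 1) * card (L i)"
      using L_card_step[of i] Suc by (intro mult_left_mono) auto
    also have "\<dots> \<le> p ^ n" using Suc by simp
    finally show ?case .
  qed
  also have "p ^ n = p ^ (i + 1) * p ^ (n - 1 - i)" using pow_split[of "i + 1" n] assms by simp
  finally show "card (L i) \<le> p ^ (n - 1 - i)" using p_gt_1 by simp
next
  have "i \<le> n - 1" using assms by simp
  then show "p ^ (n - 1 - i) \<le> card (L i)"
  proof (induction i rule: inc_induct)
    case base
    then show ?case using L_last by simp
  next
    case (step i)
    have "p ^ (n - 1 - i) = p * p ^ (n - 1 - Suc i)"
      using pow_split[of 1 "n - 1 - i"] step(2) by simp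
    also have "\<dots> \<le> p * card (L (Suc i))" using step by simp
    also have "\<dots> \<le> card (L i)" using L_card_step step by simp
    finally show ?case .
  qed
qed

lemma card_L_step:
  assumes "1 \<le> i" "i < n - 1"
  shows "card (L i) = p * card (L (Suc i))"
  using card_L[of i] card_L[of "Suc i"] assms pow_split[of 1 "n - 1 - i"] by simp

lemma card_Der: "p ^ n = p * (p * card Der)"
  using card_L[of 1] n_ge_2 pow_split[of 2 n]
  by (simp add: derived_eq_lower_central power2_eq_square mult.assoc numeral_2_eq_2)

lemma card_L2:
  assumes "n \<ge> 3"
  shows "card Der = p * card (L 2)" "card (L 2) = p ^ (n - 3)"
proof -
  have "card (L 2) = p ^ (n - 1 - 2)" using card_L[of 2] assms by linarith
  moreover have "n - 1 - 2 = n - 3" by linarith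
  ultimately show "card (L 2) = p ^ (n - 3)" by simp
  show "card Der = p * card (L 2)"
    using card_L_step[of 1] assms by (simp add: derived_eq_lower_central numeral_2_eq_2)
qed

section \<open>The centre as the last nontrivial term of the series\<close>

lemma center_eq: "Z = C (carrier G)"
  by (auto simp: grp_center_def centralizer_def)

lemma subgroup_center: "subgroup Z G"
  by (simp add: center_eq subgroup_centralizer)

lemma center_cmod: "subgroup N G \<Longrightarrow> Z \<subseteq> cmod N (carrier G)"
  unfolding center_eq centralizer_eq_cmod[OF subset_refl]
  by (auto simp: cmod_def subgroup.one_closed)

lemma center_iff: "x \<in> Z \<longleftrightarrow> x \<in> carrier G \<and> (\<forall>g\<in>carrier G. x \<otimes> g = g \<otimes> x)"
  by (auto simp: grp_center_def centralizer_def)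

text \<open>A central element of \<open>L j\<close> outside \<open>L (j + 1)\<close> would, together with \<open>L (j + 1)\<close>,
  generate a subgroup of index at most \<open>p\<close> in \<open>L j\<close> that is central modulo \<open>L (j + 2)\<close>.\<close>

lemma center_le_L: "n \<ge> 3 \<Longrightarrow> j \<le> n - 2 \<Longrightarrow> Z \<subseteq> L j"
proof (induction j)
  case 0
  then show ?case using subgroup.subset[OF subgroup_center] by simp
next
  case (Suc j)
  show ?case
  proof (rule ccontr)
    assume "\<not> ?thesis"
    then obtain z where z: "z \<in> Z" "z \<notin> L (Suc j)" by blast
    have zj: "z \<in> L j" using Suc z by auto
    let ?S = "insert z (L (Suc j))"
    let ?K = "generate G ?S"
    have Sj: "?S \<subseteq> L j" using zj lower_central_Suc_subset by blast
    then have Sc: "?S \<subseteq> carrier G" using lower_central_subset by blast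
    have K: "subgroup ?K G" using generate_is_subgroup[OF Sc] .
    have Kj: "?K \<subseteq> L j" using generate_subgroup_incl[OF Sj subgroup_lower_central] .
    have LK: "L (Suc j) \<subset> ?K" using z by (auto intro: generate.incl)
    have "?S \<subseteq> cmod (L (Suc (Suc j))) (carrier G)"
      using lower_central_cmod[of "Suc j"] center_cmod[OF subgroup_lower_central[of "Suc (Suc j)"]] z by blast
    then have Kc: "?K \<subseteq> cmod (L (Suc (Suc j))) (carrier G)"
      using generate_subgroup_incl subgroup_cmod[OF lower_central_normal subset_refl] by blast
    have cK: "p * card (L (Suc j)) \<le> card ?K"
      using card_proper_subgroup[OF subgroup_lower_central K LK] .
    show False
    proof (cases j)
      case 0
      then have "?K \<subseteq> cmod (L 2) (carrier G)" using Kc by (simp add: numeral_2_eq_2)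
      then have "p * card ?K < p * (p * card (L 1))"
        using not_central_mod_L2[OF Suc(2) K] card_Der by (simp add: derived_eq_lower_central)
      then show False using cK 0 by simp
    next
      case (Suc k)
      have "p * card (L (Suc j)) = card (L j)"
        using card_L_step[of j] Suc \<open>Suc j \<le> n - 2\<close> by simp
      then have "?K = L j" using subgroup_eqI[OF K subgroup_lower_central Kj] cK by simp
      then have "L (Suc j) \<subseteq> L (Suc (Suc j))"
        using Kc lower_central_Suc_le_iff[OF subgroup_lower_central] by blast
      then show False using L_strict[of "Suc j"] \<open>Suc j \<le> n - 2\<close> \<open>n \<ge> 3\<close> by simp
    qed
  qed
qed

lemma center_eq_L:
  assumes "n \<ge> 3"
  shows "Z = L (n - 2)"
proof
  have "Suc (n - 2) = n - 1" using assms by simp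
  then have "L (n - 2) \<subseteq> cmod {\<one>} (carrier G)" using lower_central_cmod[of "n - 2"] L_last by metis
  then show "L (n - 2) \<subseteq> Z" by (simp add: center_eq centralizer_eq_cmod)
qed (use center_le_L assms in simp)

lemma card_center: "n \<ge> 3 \<Longrightarrow> card Z = p"
  using card_L[of "n - 2"] by (simp add: center_eq_L)


lemma Der_eq_centerI: "n = 3 \<Longrightarrow> Der = Z"
  using center_eq_L by (simp add: derived_eq_lower_central)

lemma not_abelian: "n \<ge> 3 \<Longrightarrow> \<not> abelian_subgroup G (carrier G)"
proof
  assume n: "n \<ge> 3" and "abelian_subgroup G (carrier G)"
  then have "carrier G \<subseteq> Z" by (simp add: abelian_subgroup_iff center_eq)
  then have "card (carrier G) \<le> card Z" using finite_subgroup[OF subgroup_center] by (simp add: card_mono)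
  then have "p ^ n \<le> p ^ 1" using card_center n card_G by simp
  then show False using p_gt_1 n by (simp only: power_increasing_iff)
qed

section \<open>Uniqueness of normal subgroups of small index\<close>

lemma index_p_contains_Der:
  assumes "subgroup T G" "p ^ n = p * card T"
  shows "Der \<subseteq> T"
proof (rule nilpotent_maximal_contains_derived[OF nilp assms(1)])
  show "T \<noteq> carrier G" using assms p_gt_1 card_G card_pos[OF assms(1)] by auto
  show "K = T \<or> K = carrier G" if "subgroup K G" "T \<subseteq> K" for K
    using prime_index_between[OF assms(1) subgroup_self that subgroup.subset[OF that(1)] fin prime_p]
      assms card_G by simp
qed

lemma normal_if_contains_Der:
  assumes "subgroup T G" "Der \<subseteq> T"
  shows "T \<lhd> G"
  using assms derived_le_iff subgroup.subset by (intro normal_if_cmod) blast+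

lemma proper_subgroup_bound:
  assumes "subgroup H G" "H \<noteq> carrier G"
  shows "p * card H \<le> p ^ n"
  using card_proper_subgroup[OF assms(1) subgroup_self] assms subgroup.subset card_G by auto

text \<open>Some proper \<open>T\<close> contains both \<open>N\<close> and the derived subgroup. If
  T is larger than N, then T/N has order p, hence is central in G/N with quotient of order p; so G/N
  is abelian. This is what later denies normality to the other abelian subgroups of the same
  order.\<close>

lemma normal_index_p2:
  assumes N: "N \<lhd> G" and card: "card N = card Der"
  shows "N = Der"
proof -
  have s: "subgroup N G" using N by (rule normal_imp_subgroup)
  have "N \<noteq> carrier G" using card card_Der card_G p_gt_1 card_pos[OF subgroup_Der] by auto
  then obtain T where T: "subgroup T G" "T \<noteq> carrier G" "N \<subseteq> T" "Der \<subseteq> T"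
    using nilpotent_proper_subgroup[OF nilp fin s] by blast
  have "Der \<subseteq> N"
  proof (cases "N = T")
    case False
    have "p * card N \<le> card T" using card_proper_subgroup[OF s T(1)] T False by blast
    moreover have pT: "p * card T \<le> p ^ n" using proper_subgroup_bound T by blast
    then have "card T \<le> p * card N" using card_Der card p_gt_1 by simp
    ultimately have cT: "card T = p * card N" by simp
    have TN: "T \<subseteq> cmod N (carrier G)"
      using nilpotent_prime_section_central[OF nilp fin N normal_if_contains_Der T(3) prime_p cT] T by blast
    have "card (carrier G) = p * card T" using cT card_Der card card_G by simp
    then have "carrier G \<subseteq> cmod N (carrier G)"
      using prime_index_central_mod[OF N T(1) subgroup_self subgroup.subset[OF T(1)] fin prime_p _ TN] by blast
    then show ?thesis using derived_le_iff[OF s] by blast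
  qed (use T in simp)
  then show ?thesis using subgroup_eqI[OF subgroup_Der s] card by simp
qed

text \<open>The section Der/N has order p, hence is central in G/N, and that is the inclusion of
  \<open>L 2\<close> in \<open>N\<close>.\<close>

lemma normal_index_p_Der:
  assumes "n \<ge> 3" and N: "N \<lhd> G" "N \<subseteq> Der" and card: "card N = card (L 2)"
  shows "N = L 2"
proof -
  have s: "subgroup N G" using N(1) by (rule normal_imp_subgroup)
  have "Der \<subseteq> cmod N (carrier G)"
    using nilpotent_prime_section_central[OF nilp fin N(1) _ N(2) prime_p] card card_L2[OF assms(1)]
      normal_if_contains_Der[OF subgroup_Der] by simp
  then have "L 2 \<subseteq> N" using lower_central_2_le_iff[OF s] by blast
  then show ?thesis using subgroup_eqI[OF subgroup_lower_central s, of 2] card by simp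
qed

text \<open>Choose \<open>u\<close> in \<open>L (n - 3)\<close> outside the centre
  \<open>L (n - 2)\<close>. Its commutators lie in the centre, of order p, so \<open>C {u}\<close>
  has index at most p. The centre has prime index in \<open>L (n - 3)\<close>, so adding
  \<open>u\<close> to it generates everything, and whatever centralizes \<open>u\<close> centralizes
  all of \<open>L (n - 3)\<close>.\<close>

lemma card_centralizer_L:
  assumes "n \<ge> 4"
  shows "p ^ n \<le> p * card (C (L (n - 3)))"
proof -
  let ?i = "n - 3"
  have i: "Suc ?i = n - 2" "1 \<le> ?i" using assms by simp_all
  have LZ: "L (Suc ?i) = Z" using center_eq_L i assms by simp
  have sub: "L (Suc ?i) \<subseteq> L ?i" by (rule lower_central_Suc_subset)
  have "?i < n - 1" using assms by linarith
  then obtain u where u: "u \<in> L ?i" "u \<notin> L (Suc ?i)" using L_strict[of ?i] by blast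
  have uc: "u \<in> carrier G" using u lower_central_subset by blast
  have "carrier G \<subseteq> cmod (L (Suc ?i)) (L ?i)"
    using cmod_sym[OF subgroup_lower_central lower_central_subset subset_refl lower_central_cmod] .
  then have "comm g u \<in> L (Suc ?i)" if "g \<in> carrier G" for g using that u by (auto simp: cmod_def)
  then have bound: "p ^ n \<le> p * card (C {u})"
    using card_centralizer_bound[OF fin lower_central_subset[of "Suc ?i"] uc] card_center LZ card_G assms
    by (simp add: order_def)
  let ?D = "C {u}"
  have Dc: "?D \<subseteq> carrier G" by (auto simp: centralizer_def)
  let ?K = "L ?i \<inter> C ?D"
  have "subgroup ?K G" using subgroup_lower_central subgroup_centralizer[OF Dc] by (simp add: subgroups_Inter_pair)
  moreover have "L (Suc ?i) \<subseteq> ?K" using sub LZ Dc by (auto simp: center_iff centralizer_def)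
  moreover have "u \<in> ?K" using u uc by (auto simp: centralizer_def)
  moreover have "card (L ?i) = p * card (L (Suc ?i))" using card_L_step[of ?i] i assms by simp
  ultimately have "?K = L ?i"
    using prime_index_between[OF subgroup_lower_central[of "Suc ?i"] subgroup_lower_central[of ?i], of ?K] fin prime_p u by blast
  then have "L ?i \<subseteq> C ?D" by blast
  then have "?D \<subseteq> C (L ?i)" using centralizer_sym Dc lower_central_subset by blast
  then have "card ?D \<le> card (C (L ?i))"
    using finite_subgroup[OF subgroup_centralizer[OF lower_central_subset]] by (simp add: card_mono)
  then have "p * card ?D \<le> p * card (C (L ?i))" by simp
  then show ?thesis using bound by linarith
qed

end

section \<open>Order \<open>p\<^sup>3\<close> and abelian subgroups of index \<open>p\<close>\<close>

lemma mult_le_mult_eqD: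
  assumes "(a::nat) \<le> c" "b \<le> d" "a * b = c * d" "c * d > 0"
  shows "a = c" "b = d"
proof -
  have le: "a * b \<le> a * d" "a * d \<le> c * d" using assms(1,2) by simp_all
  have "a * d = c * d" using le assms(3) by linarith
  then show a: "a = c" using assms(4) by simp
  have "a * b = a * d" using le assms(3) by linarith
  then show "b = d" using assms(4) a by simp
qed

lemma (in group) CD_eqI:
  assumes "finite (carrier G)" "subgroup H G" "mG G H = m" "\<And>K. subgroup K G \<Longrightarrow> mG G K \<le> m"
  shows "CD G = {K. subgroup K G \<and> mG G K = m}"
proof -
  have "finite {K. subgroup K G}"
    by (rule finite_subset[of _ "Pow (carrier G)"]) (use assms(1) in \<open>auto dest: subgroup.subset\<close>)
  then have "finite {mG G K | K. subgroup K G}" by simp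
  then have "m_star G = m" unfolding m_star_def by (rule Max_eqI) (use assms in auto)
  then show ?thesis by (simp add: CD_def)
qed

context maximal_class
begin

lemma subgroup_C: "subgroup H G \<Longrightarrow> subgroup (C H) G"
  using subgroup_centralizer subgroup.subset by blast

lemma card_mono_subgroup: "H \<subseteq> K \<Longrightarrow> subgroup K G \<Longrightarrow> card H \<le> card K"
  using card_mono[OF finite_subgroup] by blast

lemma le_C_C: "subgroup H G \<Longrightarrow> H \<subseteq> C (C H)"
  using centralizer_sym subgroup.subset subgroup_C by blast

lemma C_carrier_imp: "subgroup H G \<Longrightarrow> C H = carrier G \<Longrightarrow> H \<subseteq> Z"
  using le_C_C center_eq by metis

lemma card_le_center: "H \<subseteq> Z \<Longrightarrow> n \<ge> 3 \<Longrightarrow> card H \<le> p"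
  using card_mono_subgroup[OF _ subgroup_center] card_center by metis

lemma C_of_abelian_index_p:
  assumes "n \<ge> 3" "abelian_subgroup G A" "p ^ n = p * card A"
  shows "C A = A"
proof -
  have A: "subgroup A G" "A \<subseteq> C A" using assms(2) by (simp_all add: abelian_subgroup_iff)
  have idx: "card (carrier G) = p * card A" using assms(3) card_G by simp
  have "C A = A \<or> C A = carrier G"
    using prime_index_between[OF A(1) subgroup_self subgroup_C[OF A(1)] A(2) _ fin prime_p idx]
      subgroup.subset[OF subgroup_C[OF A(1)]] by blast
  moreover have "C A \<noteq> carrier G"
  proof
    assume "C A = carrier G"
    then have "A \<subseteq> C (carrier G)" using C_carrier_imp[OF A(1)] center_eq by simp
    then have "abelian_subgroup G (carrier G)"
      using prime_index_central_abelian[OF A(1) subgroup_self subgroup.subset[OF A(1)] fin prime_p idx] by blast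
    then show False using not_abelian assms(1) by blast
  qed
  ultimately show ?thesis by blast
qed

text \<open>Outside \<open>A\<close> only the centre of \<open>G\<close> survives in \<open>C H \<inter> A\<close>, because \<open>H\<close> and \<open>A\<close> together generate \<open>G\<close>.\<close>

lemma CD_abelian_index_p:
  assumes "n > 3" "abelian_subgroup G A" "p ^ n = p * card A"
  shows "CD G = {A}"
proof -
  have n3: "n \<ge> 3" using assms by simp
  have A: "subgroup A G" and Aab: "A \<subseteq> C A" using assms(2) by (simp_all add: abelian_subgroup_iff)
  have idx: "card (carrier G) = p * card A" using assms(3) card_G by simp
  let ?a = "card A"
  have a0: "?a > 0" using card_pos[OF A] .
  have "p ^ n = p * p ^ (n - 1)" using assms(1) pow_split[of 1 n] by simp
  then have "?a = p ^ (n - 1)" using assms(3) p_gt_1 by simp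
  then have ap: "p ^ 3 \<le> ?a" using p_gt_1 assms(1) by (simp add: power_increasing)
  \<comment> \<open>This is where n > 3 enters: p^2 will bound the centralizer of any subgroup not
    inside \<open>A\<close>, while |A| is at least p^3.\<close>
  have pp: "p * p < ?a"
  proof -
    have "p * p < p ^ 3" using p_gt_1 by (simp add: power3_eq_cube)
    then show ?thesis using ap by simp
  qed
  have CA: "C A = A" using C_of_abelian_index_p[OF n3 assms(2,3)] .
  have less: "mG G H < ?a * ?a" if H: "subgroup H G" and "H \<noteq> A" for H
  proof (cases "H \<subseteq> A")
    case True
    have "A \<subseteq> C H" using Aab centralizer_mono[OF True] by blast
    then have "C H = A \<or> C H = carrier G"
      using prime_index_between[OF A subgroup_self subgroup_C[OF H] _ _ fin prime_p idx]
        subgroup.subset[OF subgroup_C[OF H]] by blast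
    then show ?thesis
    proof
      assume "C H = A"
      moreover have "card H < card A" using True that finite_subgroup[OF A] by (simp add: psubset_card_mono psubset_eq)
      ultimately show ?thesis using a0 by (simp add: mG_def)
    next
      assume c: "C H = carrier G"
      then have "card H \<le> p" using card_le_center[OF C_carrier_imp[OF H]] n3 by blast
      then have "mG G H \<le> p * (p * ?a)" using c idx by (simp add: mG_def)
      also have "\<dots> < ?a * ?a" using pp a0 by simp
      finally show ?thesis .
    qed
  next
    case False
    then obtain h where h: "h \<in> H" "h \<notin> A" by blast
    have hc: "h \<in> carrier G" using H h by (simp add: subgroup.mem_carrier)
    let ?D = "C H"
    have D: "subgroup ?D G" using subgroup_C[OF H] .
    have DA: "?D \<inter> A \<subseteq> Z"
    proof
      fix x assume x: "x \<in> ?D \<inter> A"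
      have xc: "x \<in> carrier G" using x by (simp add: centralizer_def)
      have Cx: "subgroup (C {x}) G" using xc by (simp add: subgroup_centralizer)
      have "A \<subseteq> C {x}" using Aab x by (auto simp: centralizer_def)
      moreover have "h \<in> C {x}" using x h hc by (auto simp: centralizer_def)
      ultimately have "C {x} = carrier G"
        using prime_index_between[OF A subgroup_self Cx _ subgroup.subset[OF Cx] fin prime_p idx] h by blast
      then have "x \<otimes> g = g \<otimes> x" if "g \<in> carrier G" for g
      proof -
        have "g \<in> C {x}" using that \<open>C {x} = carrier G\<close> by simp
        then show ?thesis by (simp add: centralizer_def)
      qed
      then show "x \<in> Z" using xc by (simp add: center_iff)
    qed
    \<comment> \<open>As |G:A| = p, the product bound gives |C H| \<le> p |C H \<inter> A|, and the
      intersection is central, of order at most p.\<close>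
    have "card ?D * card A \<le> card (carrier G) * card (?D \<inter> A)"
      using card_product_bound[OF D A subgroup_self] D A fin by (simp add: subgroup.subset)
    also have "\<dots> \<le> (p * ?a) * p" using card_le_center[OF DA n3] idx by (simp add: mult_le_mono)
    also have "\<dots> = (p * p) * ?a" by simp
    finally have cD: "card ?D \<le> p * p" using a0 by simp
    show ?thesis
    proof (cases "H = carrier G")
      case True
      then have "mG G H = (p * ?a) * p" using idx card_center[OF n3] by (simp add: mG_def flip: center_eq)
      also have "\<dots> = (p * p) * ?a" by simp
      also have "\<dots> < ?a * ?a" using pp a0 by simp
      finally show ?thesis .
    next
      case False
      then have "p * card H \<le> p * ?a" using proper_subgroup_bound[OF H] assms(3) by simp
      then have "card H \<le> ?a" using p_gt_1 by simp
      then have "mG G H \<le> ?a * (p * p)" unfolding mG_def using cD by (rule mult_le_mono)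
      also have "\<dots> < ?a * ?a" using pp a0 by simp
      finally show ?thesis .
    qed
  qed
  have mA: "mG G A = ?a * ?a" using CA by (simp add: mG_def)
  have "mG G K \<le> ?a * ?a" if "subgroup K G" for K
  proof (cases "K = A")
    case False
    then show ?thesis using less[OF that] by simp
  next
    case True
    show ?thesis unfolding True mA ..
  qed
  then have "CD G = {K. subgroup K G \<and> mG G K = ?a * ?a}"
    by (rule CD_eqI[OF fin A mA])
  moreover have "mG G K \<noteq> ?a * ?a" if "subgroup K G" "K \<noteq> A" for K
    using less[OF that] by (rule less_imp_neq)
  ultimately show ?thesis using mA A by blast
qed

text \<open>The centre and \<open>G\<close> give p * p^3, an abelian subgroup of order p^2 gives p^2
  * p^2, and these coincide. A noncentral proper subgroup and its centralizer are both proper, so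
  each has order at most p^2.\<close>

lemma CD_order_p3:
  assumes n: "n = 3"
  defines "I \<equiv> {H. subgroup H G \<and> Z \<subseteq> H \<and> H \<subseteq> carrier G \<and> card H = p * card Z}"
  shows "CD G = {Z, carrier G} \<union> I"
proof -
  have n3: "n \<ge> 3" using n by simp
  have cZ: "card Z = p" using card_center[OF n3] .
  have cG: "card (carrier G) = p ^ 3" using card_G n by simp
  have p0: "p > 0" using p_gt_1 by simp
  have up: "mG G H \<le> p ^ 4 \<and> (mG G H = p ^ 4 \<longrightarrow> H \<in> {Z, carrier G} \<union> I)" if H: "subgroup H G" for H
  proof -
    let ?D = "C H"
    have D: "subgroup ?D G" using subgroup_C[OF H] .
    have bnd: "card K \<le> p ^ 2" if "subgroup K G" "K \<noteq> carrier G" for K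
      using proper_subgroup_bound[OF that] n p0 by (simp add: power3_eq_cube power2_eq_square)
    consider "H = carrier G" | "H \<subseteq> Z" | "H \<noteq> carrier G" "\<not> H \<subseteq> Z" by blast
    then show ?thesis
    proof cases
      case 1
      then have "mG G H = p ^ 3 * p" using cG cZ by (simp add: mG_def flip: center_eq)
      then show ?thesis using 1 by (simp add: eval_nat_numeral)
    next
      case 2
      have cH: "card H \<le> p" using card_le_center[OF 2 n3] .
      moreover have cD: "card ?D \<le> p ^ 3"
        using card_mono_subgroup[OF subgroup.subset[OF D] subgroup_self] cG by simp
      ultimately have "mG G H \<le> p * p ^ 3" unfolding mG_def by (rule mult_le_mono)
      moreover have "H \<in> {Z, carrier G} \<union> I" if "mG G H = p * p ^ 3"
      proof -
        have "card Z \<le> card H" unfolding cZ using mult_le_mult_eqD(1)[OF cH cD] that p0 by (simp add: mG_def)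
        then show ?thesis using subgroup_eqI[OF H subgroup_center 2] by blast
      qed
      ultimately show ?thesis by (simp add: eval_nat_numeral)
    next
      case 3
      have "?D \<noteq> carrier G" using C_carrier_imp[OF H] 3 by blast
      then have cD: "card ?D \<le> p ^ 2" using bnd D by blast
      have cH: "card H \<le> p ^ 2" using bnd H 3 by blast
      have "mG G H \<le> p ^ 2 * p ^ 2" unfolding mG_def using cH cD by (rule mult_le_mono)
      moreover have "H \<in> I" if "mG G H = p ^ 2 * p ^ 2"
      proof -
        have eq: "card H = p ^ 2" "card ?D = p ^ 2"
          using mult_le_mult_eqD[OF cH cD] that p0 by (simp_all add: mG_def)
        \<comment> \<open>The double centralizer of \<open>H\<close> always contains the centre. If
          \<open>H\<close> did not, the double centralizer would be larger than \<open>H\<close>,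
          hence all of \<open>G\<close>, and \<open>C H\<close> of order p^2 would be
          central.\<close>
        have "Z \<subseteq> H"
        proof (rule ccontr)
          assume nZ: "\<not> Z \<subseteq> H"
          let ?K = "C ?D"
          have HK: "H \<subseteq> ?K" using le_C_C[OF H] .
          have ZK: "Z \<subseteq> ?K" using subgroup.subset[OF D] by (auto simp: center_iff centralizer_def)
          have K: "subgroup ?K G" using subgroup_C[OF D] .
          have "H \<subset> ?K" using HK ZK nZ by blast
          then have "p * card H \<le> card ?K" using card_proper_subgroup[OF H K] by blast
          then have "p ^ 3 \<le> card ?K" using eq by (simp add: eval_nat_numeral)
          moreover have "p ^ 2 < p ^ 3" using p_gt_1 by (intro power_strict_increasing) auto
          ultimately have "?K = carrier G" using bnd[OF K] by linarith
          then have "?D \<subseteq> Z" using C_carrier_imp[OF D] by blast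
          then have "p ^ 2 \<le> p ^ 1" using card_le_center[OF _ n3, of ?D] eq by simp
          then show False using p_gt_1 by (simp only: power_increasing_iff)
        qed
        then show ?thesis using H eq cZ subgroup.subset[OF H] by (simp add: I_def power2_eq_square)
      qed
      ultimately show ?thesis by (simp flip: power_add)
    qed
  qed
  have mGG: "mG G (carrier G) = p ^ 4" using cG cZ by (simp add: mG_def eval_nat_numeral flip: center_eq)
  have eq: "CD G = {K. subgroup K G \<and> mG G K = p ^ 4}"
    by (rule CD_eqI[OF fin subgroup_self mGG]) (use up in blast)
  have "C Z = carrier G" by (auto simp: center_iff centralizer_def)
  then have "Z \<in> CD G" using eq cG cZ subgroup_center by (simp add: mG_def eval_nat_numeral)
  moreover have "carrier G \<in> CD G" using eq mGG subgroup_self by simp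
  moreover have "H \<in> CD G" if "H \<in> I" for H
  proof -
    have H: "subgroup H G" "Z \<subseteq> H" "card H = p * card Z" using that by (simp_all add: I_def)
    have "Z \<subseteq> C H" using subgroup.subset[OF H(1)] by (auto simp: center_iff centralizer_def)
    then have "abelian_subgroup G H"
      using prime_index_central_abelian[OF subgroup_center H(1,2) fin prime_p H(3)] by blast
    then have "H \<subseteq> C H" by (simp add: abelian_subgroup_iff)
    then have "card H * card H \<le> mG G H"
      unfolding mG_def using card_mono_subgroup[OF _ subgroup_C[OF H(1)]] by simp
    then have "p ^ 4 \<le> mG G H" using H cZ by (simp add: eval_nat_numeral mult.assoc)
    then show ?thesis using up[OF H(1)] H(1) eq by simp
  qed
  moreover have "CD G \<subseteq> {Z, carrier G} \<union> I" using up eq by blast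
  ultimately show ?thesis by blast
qed

end

section \<open>No abelian subgroup of index \<open>p\<close>\<close>

context maximal_class
begin

text \<open>Adjoining \<open>x\<close> to the abelian derived subgroup, of index p^2, yields an
  abelian group of index at most p, and not \<open>G\<close> itself. Contrapositively, without an
  abelian subgroup of index p the derived subgroup is self-centralizing.\<close>

lemma abelian_index_p_if_centralizing:
  assumes "n \<ge> 3" and ab: "abelian_subgroup G Der" and x: "x \<in> C Der" "x \<notin> Der"
  shows "\<exists>A. abelian_subgroup G A \<and> p ^ n = p * card A"
proof -
  let ?S = "insert x Der"
  let ?K = "generate G ?S"
  have xc: "x \<in> carrier G" using x by (simp add: centralizer_def)
  then have Sc: "?S \<subseteq> carrier G" using Der_subset by simp
  have d: "\<forall>a\<in>Der. \<forall>b\<in>Der. a \<otimes> b = b \<otimes> a" using ab by (simp add: abelian_subgroup_def)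
  have xd: "\<forall>b\<in>Der. x \<otimes> b = b \<otimes> x" using x by (simp add: centralizer_def)
  have "a \<otimes> b = b \<otimes> a" if "a \<in> ?S" "b \<in> ?S" for a b
    using that
  proof (elim insertE)
    assume "a = x" "b \<in> Der"
    then show ?thesis using xd by blast
  next
    assume "a \<in> Der" "b = x"
    then show ?thesis using xd by simp
  next
    assume "a \<in> Der" "b \<in> Der"
    then show ?thesis using d by blast
  qed simp
  then have "?S \<subseteq> C ?S" unfolding centralizer_def using Sc by auto
  then have Kab: "abelian_subgroup G ?K" by (rule abelian_generate[OF Sc])
  have K: "subgroup ?K G" using generate_is_subgroup[OF Sc] .
  have "x \<in> ?K" "Der \<subseteq> ?K" by (auto intro: generate.incl)
  then have "Der \<subset> ?K" using x by blast
  then have "p * card Der \<le> card ?K" using card_proper_subgroup[OF subgroup_Der K] by blast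
  then have "p ^ n \<le> p * card ?K" using card_Der by simp
  moreover have "p * card ?K \<le> p ^ n"
  proof (rule proper_subgroup_bound[OF K])
    show "?K \<noteq> carrier G" using Kab not_abelian[OF assms(1)] by auto
  qed
  ultimately have "p ^ n = p * card ?K" by (rule le_antisym)
  then show ?thesis using Kab by blast
qed

lemma Der_proper: "Der \<noteq> carrier G"
proof
  assume "Der = carrier G"
  then have "card Der = p ^ n" using card_G by simp
  then have "p * (p * card Der) = card Der" unfolding card_Der ..
  then show False using p_gt_1 card_pos[OF subgroup_Der] by simp
qed

text \<open>The source of the bound n > 4. For n = 2 the group is abelian and a subgroup of order p
  comes from Sylow. For n = 3 the derived subgroup is the centre, so anything outside centralizes
  it. For n = 4 it is \<open>L (n - 3)\<close>, whose centralizer has index at most p and therefore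
  exceeds it.\<close>

lemma exists_abelian_index_p:
  assumes "n \<le> 4" and ab: "abelian_subgroup G Der"
  shows "\<exists>A. abelian_subgroup G A \<and> p ^ n = p * card A"
proof -
  have DC: "Der \<subseteq> C Der" using ab by (simp add: abelian_subgroup_iff)
  consider "n = 2" | "n = 3" | "n = 4" using n_ge_2 assms(1) by linarith
  then show ?thesis
  proof cases
    case 1
    then have "Der = {\<one>}" using L_last by (simp add: derived_eq_lower_central)
    then have "carrier G \<subseteq> C (carrier G)"
      using derived_le_iff[OF triv_subgroup] by (simp add: centralizer_eq_cmod)
    moreover obtain H where H: "subgroup H G" "card H = p ^ 1"
      using sylow_thm[OF prime_p is_group _ fin, of 1 p] card_G 1 by (auto simp: order_def power2_eq_square)
    ultimately have "abelian_subgroup G H"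
      using subgroup.subset[OF H(1)] centralizer_mono[of H "carrier G"] by (auto simp: abelian_subgroup_iff)
    then show ?thesis using H 1 by (auto simp: power2_eq_square)
  next
    case 2
    obtain x where x: "x \<in> carrier G" "x \<notin> Der" using Der_subset Der_proper by blast
    then have "x \<in> C Der" unfolding Der_eq_centerI[OF 2] by (simp add: centralizer_def center_iff)
    then show ?thesis using abelian_index_p_if_centralizing[OF _ ab] x 2 by simp
  next
    case 3
    have "L (n - 3) = Der" using 3 by (simp add: derived_eq_lower_central)
    moreover have "n \<ge> 4" using 3 by simp
    ultimately have "p ^ n \<le> p * card (C Der)" using card_centralizer_L by simp
    then have "p * (p * card Der) \<le> p * card (C Der)" unfolding card_Der .
    then have le: "p * card Der \<le> card (C Der)" using p_gt_1 by simp
    have "C Der \<noteq> Der"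
    proof
      assume "C Der = Der"
      then have "p * card Der \<le> card Der" using le by simp
      then show False using p_gt_1 card_pos[OF subgroup_Der] by simp
    qed
    then obtain x where "x \<in> C Der" "x \<notin> Der" using DC by blast
    then show ?thesis using abelian_index_p_if_centralizing[OF _ ab] 3 by simp
  qed
qed

end

locale no_abelian_index_p = maximal_class +
  assumes Der_abelian: "abelian_subgroup G Der"
    and no_abelian: "\<not> (\<exists>A. abelian_subgroup G A \<and> p ^ n = p * card A)"
begin

lemma n_ge_5: "n \<ge> 5"
proof (rule ccontr)
  assume "\<not> ?thesis"
  then have "n \<le> 4" by simp
  then show False using exists_abelian_index_p Der_abelian no_abelian by blast
qed

text \<open>The unit of measurement below: |G| = p^3 q, a subgroup of index p has order p^2 q, |Der|
  = pq, and the value of the measure at \<open>Der\<close> is (pq)^2.\<close>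

abbreviation "q \<equiv> card (L 2)"
abbreviation "W h \<equiv> Der \<inter> C {h}"

lemma q_pos: "q > 0"
  using card_pos subgroup_lower_central by blast

lemma card_Der_q: "card Der = p * q" and pow_n_q: "p ^ n = p * (p * (p * q))" and q_eq: "q = p ^ (n - 3)"
  using card_L2 card_Der n_ge_5 by simp_all

lemma card_G_q: "card (carrier G) = p ^ 3 * q"
  using card_G pow_n_q by (simp add: power3_eq_cube mult.assoc)

lemma q_ge: "p ^ 2 \<le> q" and q_eq_iff: "q = p ^ 2 \<longleftrightarrow> n = 5"
proof -
  have "2 \<le> n - 3" using n_ge_5 by linarith
  then show "p ^ 2 \<le> q" unfolding q_eq using p_gt_1 by (simp add: power_increasing)
  have "q = p ^ 2 \<longleftrightarrow> n - 3 = 2" unfolding q_eq using p_gt_1 by (simp add: power_inject_exp)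
  then show "q = p ^ 2 \<longleftrightarrow> n = 5" using n_ge_5 by linarith
qed

lemma card_Z: "card Z = p"
  using card_center n_ge_5 by simp

lemma center_subset_Der: "Z \<subseteq> Der"
  using center_le_L[of 1] n_ge_5 by (simp add: derived_eq_lower_central)

lemma Der_subset_C: "Der \<subseteq> C Der"
  using Der_abelian by (simp add: abelian_subgroup_iff)

lemma C_Der: "C Der = Der"
  using abelian_index_p_if_centralizing[OF _ Der_abelian] no_abelian n_ge_5 Der_subset_C by force

lemma Der_subset_C_if: "H \<subseteq> Der \<Longrightarrow> Der \<subseteq> C H"
  using Der_subset_C centralizer_mono by blast

lemma subgroup_W: "h \<in> carrier G \<Longrightarrow> subgroup (W h) G"
  using subgroup_Der subgroup_centralizer by (simp add: subgroups_Inter_pair)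

lemma card_W_le:
  assumes "h \<in> carrier G" "h \<notin> Der"
  shows "card (W h) \<le> q"
proof -
  have "W h \<noteq> Der"
  proof
    assume "W h = Der"
    then have "Der \<subseteq> C {h}" by blast
    then have "{h} \<subseteq> C Der" using centralizer_sym assms Der_subset by blast
    then show False using C_Der assms by blast
  qed
  then have "p * card (W h) \<le> p * q"
    using card_proper_subgroup[OF subgroup_W subgroup_Der] assms card_Der_q by auto
  then show ?thesis using p_gt_1 by simp
qed

text \<open>The conjugate of \<open>w\<close> by \<open>g\<close> commutes with \<open>h\<close>
  exactly when \<open>w\<close> commutes with g^-1 h g = h [h^-1, g^-1]. The commutator factor lies
  in the abelian \<open>Der\<close> and so commutes with \<open>w\<close> anyway; only
  \<open>h\<close> matters.\<close>

lemma W_normal: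
  assumes h: "h \<in> carrier G"
  shows "W h \<lhd> G"
  unfolding normal_inv_iff
proof (intro conjI ballI subgroup_W[OF h])
  fix g w assume g: "g \<in> carrier G" and w: "w \<in> W h"
  have wD: "w \<in> Der" and wc: "w \<in> carrier G" using w Der_subset by blast+
  have "g \<otimes> w \<otimes> inv g \<in> Der"
    using normal_if_contains_Der[OF subgroup_Der] g wD by (auto simp: normal_inv_iff)
  moreover have "g \<otimes> w \<otimes> inv g \<in> C {h}"
  proof -
    let ?k = "inv g \<otimes> h \<otimes> g"
    have kc: "?k \<in> carrier G" using g h by simp
    have Cw: "subgroup (C {w}) G" using wc by (simp add: subgroup_centralizer)
    have "carrier G \<subseteq> cmod Der (carrier G)" using derived_le_iff[OF subgroup_Der] by blast
    then have "comm (inv h) (inv g) \<in> Der"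
      unfolding cmod_def using inv_closed[OF g] inv_closed[OF h] by blast
    then have "comm (inv h) (inv g) \<in> C {w}" using Der_subset_C_if[of "{w}"] wD by blast
    moreover have "h \<in> C {w}" using w h by (auto simp: centralizer_def)
    ultimately have "h \<otimes> comm (inv h) (inv g) \<in> C {w}" using Cw by (simp add: subgroup.m_closed)
    then have "?k \<in> C {w}" using g h by (simp add: free_reduce)
    then have kw: "?k \<otimes> w = w \<otimes> ?k" by (simp add: centralizer_def)
    have "(g \<otimes> w \<otimes> inv g) \<otimes> h = g \<otimes> (w \<otimes> ?k) \<otimes> inv g" using g h wc by (simp add: free_reduce)
    also have "\<dots> = h \<otimes> (g \<otimes> w \<otimes> inv g)" unfolding kw[symmetric] using g h wc by (simp add: free_reduce)
    finally show ?thesis using g wc by (simp add: centralizer_def)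
  qed
  ultimately show "g \<otimes> w \<otimes> inv g \<in> W h" by blast
qed

lemma W_eq_L2: "h \<in> carrier G \<Longrightarrow> card (W h) = q \<Longrightarrow> W h = L 2"
  using normal_index_p_Der[OF _ W_normal] n_ge_5 by simp

section \<open>The candidate \<open>T\<close> and the subgroups on which the bound is
  attained\<close>

abbreviation "T \<equiv> C (L 2)"

lemma subgroup_T: "subgroup T G"
  by (rule subgroup_C[OF subgroup_lower_central])

lemma Der_subset_T: "Der \<subseteq> T"
  using Der_subset_C_if L2_subset_Der by blast

lemma T_proper: "T \<noteq> carrier G"
proof
  assume "T = carrier G"
  then have "L 2 \<subseteq> Z" by (rule C_carrier_imp[OF subgroup_lower_central])
  then have "q \<le> p" using card_le_center n_ge_5 by simp
  then have "p ^ 2 \<le> p ^ 1" using q_ge by simp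
  then show False using p_gt_1 by (simp only: power_increasing_iff)
qed

lemma card_bound_if_proper: "subgroup H G \<Longrightarrow> H \<noteq> carrier G \<Longrightarrow> card H \<le> p ^ 2 * q"
  using proper_subgroup_bound p_gt_1 pow_n_q by (simp add: power2_eq_square mult.assoc)

lemma card_if_above_Der:
  assumes "subgroup H G" "Der \<subset> H"
  shows "p ^ 2 * q \<le> card H"
  using card_proper_subgroup[OF subgroup_Der assms] card_Der_q by (simp add: power2_eq_square mult.assoc)

text \<open>One \<open>h\<close> in \<open>T\<close> outside \<open>Der\<close> determines
  everything. \<open>L 2\<close> lies in \<open>W h\<close>, which has at most q elements, so they
  agree. The centre of \<open>T\<close> centralizes \<open>Der\<close>, hence lies in it, and it
  commutes with \<open>h\<close>, hence lies in \<open>W h\<close>.\<close>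

lemma T_structure:
  assumes "h \<in> T" "h \<notin> Der"
  shows "card T = p ^ 2 * q" "grp_center G T = L 2" "W h = L 2"
proof -
  have hc: "h \<in> carrier G" using assms by (simp add: centralizer_def)
  show "card T = p ^ 2 * q"
  proof (rule le_antisym[OF card_bound_if_proper[OF subgroup_T T_proper] card_if_above_Der[OF subgroup_T]])
    show "Der \<subset> T" using Der_subset_T assms by blast
  qed
  have LC: "L 2 \<subseteq> C T" by (rule le_C_C[OF subgroup_lower_central])
  have "L 2 \<subseteq> C {h}" using LC centralizer_mono[of "{h}" T] assms by blast
  then have "L 2 \<subseteq> W h" using L2_subset_Der by blast
  then show WL: "W h = L 2"
    using subgroup_eqI[OF subgroup_lower_central subgroup_W[OF hc]] card_W_le[OF hc assms(2)] by auto
  have "C T \<subseteq> C Der" using centralizer_mono[OF Der_subset_T] .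
  then have "grp_center G T \<subseteq> Der" using C_Der by (auto simp: grp_center_def)
  moreover have "grp_center G T \<subseteq> C {h}" using centralizer_mono[of "{h}" T] assms by (auto simp: grp_center_def)
  ultimately have "grp_center G T \<subseteq> L 2" using WL by blast
  moreover have "L 2 \<subseteq> grp_center G T" using LC L2_subset_Der Der_subset_T by (auto simp: grp_center_def)
  ultimately show "grp_center G T = L 2" by blast
qed

lemma centralizer_Der_part: "c \<in> C H \<Longrightarrow> H \<inter> Der \<subseteq> W c"
  by (auto simp: centralizer_def dest: subsetD[OF Der_subset])

lemma centralizer_part: "h \<in> H \<Longrightarrow> C H \<inter> Der \<subseteq> W h"
  by (auto simp: centralizer_def)

text \<open>The product bound is used inside a proper subgroup that contains both \<open>H\<close>
  and \<open>Der\<close>, of order at most p^2 q. In \<open>G\<close> itself the factor would be p^2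
  instead of p.\<close>

lemma card_le_if_proper:
  assumes "subgroup H G" "H \<noteq> carrier G"
  shows "card H \<le> p * card (H \<inter> Der)"
proof -
  obtain S where S: "subgroup S G" "S \<noteq> carrier G" "H \<subseteq> S" "Der \<subseteq> S"
    using nilpotent_proper_subgroup[OF nilp fin assms] by blast
  have "card H * (p * q) \<le> card S * card (H \<inter> Der)"
    using card_product_bound[OF assms(1) subgroup_Der S(1,3,4) fin] card_Der_q by simp
  also have "\<dots> \<le> (p ^ 2 * q) * card (H \<inter> Der)" using card_bound_if_proper[OF S(1,2)] by simp
  also have "\<dots> = (p * card (H \<inter> Der)) * (p * q)" by (simp add: power2_eq_square)
  finally show ?thesis using p_gt_1 q_pos by simp
qed

definition "I = {H. subgroup H G \<and> L 2 \<subseteq> H \<and> H \<subseteq> T \<and> card H = p * q}"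

text \<open>The possible members of \<open>CD G\<close>, as an upper estimate. The conditions on
  \<open>T\<close> keep the last clause from applying when \<open>T\<close> collapses to
  \<open>Der\<close>.\<close>

definition "extremal H \<longleftrightarrow> H = Der \<or> n = 5 \<and> (H = carrier G \<or> H = Z)
  \<or> card T = p ^ 2 * q \<and> grp_center G T = L 2 \<and> (H = L 2 \<or> H = T \<or> H \<in> I)"

lemma extremal_T: "h \<in> T \<Longrightarrow> h \<notin> Der \<Longrightarrow> H = L 2 \<or> H = T \<or> H \<in> I \<Longrightarrow> extremal H"
  using T_structure by (simp add: extremal_def)

text \<open>p^4 q is the value of the measure at \<open>G\<close> and at its centre. Against (pq)^2
  it amounts to comparing p^2 with q = p^(n-3).\<close>

lemma p4q: "p ^ 4 * q \<le> (p * q) * (p * q)" "p ^ 4 * q = (p * q) * (p * q) \<Longrightarrow> n = 5"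
proof -
  have eq: "p ^ 4 * q = p ^ 2 * (p ^ 2 * q)" "(p * q) * (p * q) = p ^ 2 * (q * q)"
    by (simp_all add: eval_nat_numeral)
  show "p ^ 4 * q \<le> (p * q) * (p * q)" unfolding eq by (intro mult_le_mono le_refl q_ge)
  show "n = 5" if "p ^ 4 * q = (p * q) * (p * q)"
  proof -
    have "p ^ 2 * (p ^ 2 * q) = p ^ 2 * (q * q)" using that unfolding eq .
    then have "p ^ 2 * q = q * q" using p_gt_1 by (simp only: mult_cancel1 power_eq_0_iff) auto
    then have "q = p ^ 2" using q_pos by simp
    then show ?thesis using q_eq_iff by blast
  qed
qed

text \<open>\<open>C H\<close> contains \<open>Der\<close>. If it is all of \<open>G\<close>, then
  \<open>H\<close> is central; if it is \<open>Der\<close>, the bound is immediate. Otherwise some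
  \<open>c\<close> outside \<open>Der\<close> centralizes \<open>H\<close>, so \<open>H\<close> lies
  in \<open>W c\<close>, and the balance is q against p^2 q.\<close>

lemma mG_inside_Der:
  assumes H: "subgroup H G" "H \<subseteq> Der"
  shows "mG G H \<le> (p * q) * (p * q) \<and> (mG G H = (p * q) * (p * q) \<longrightarrow> extremal H)"
proof -
  let ?D = "C H"
  have D: "subgroup ?D G" using subgroup_C[OF H(1)] .
  have DerD: "Der \<subseteq> ?D" using Der_subset_C_if[OF H(2)] .
  consider "?D = carrier G" | "?D = Der" | "?D \<noteq> carrier G" "Der \<subset> ?D" using DerD by blast
  then show ?thesis
  proof cases
    case 1
    then have HZ: "H \<subseteq> Z" using C_carrier_imp[OF H(1)] by blast
    have m: "mG G H = card H * (p ^ 3 * q)" using 1 card_G_q by (simp add: mG_def)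
    have cH: "card H \<le> p" using card_le_center[OF HZ] n_ge_5 by simp
    have "mG G H \<le> p * (p ^ 3 * q)" unfolding m using cH by simp
    moreover have p4: "p * (p ^ 3 * q) = p ^ 4 * q" by (simp add: eval_nat_numeral)
    ultimately have le: "mG G H \<le> p ^ 4 * q" by simp
    have "extremal H" if eq: "mG G H = (p * q) * (p * q)"
    proof -
      have "p ^ 4 * q = (p * q) * (p * q)" using le eq p4q(1) by linarith
      then have n: "n = 5" and "mG G H = p ^ 4 * q" using p4q(2) eq by (blast, argo)
      then have "card H * (p ^ 3 * q) = p * (p ^ 3 * q)" unfolding m p4 by blast
      then have "card H = p" using p_gt_1 q_pos by simp
      then have "H = Z" using subgroup_eqI[OF H(1) subgroup_center HZ] card_Z by simp
      then show ?thesis using n unfolding extremal_def by blast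
    qed
    then show ?thesis using le p4q(1) by linarith
  next
    case 2
    have m: "mG G H = card H * (p * q)" using 2 card_Der_q by (simp add: mG_def)
    have cH: "card H \<le> p * q" using card_mono_subgroup[OF H(2) subgroup_Der] card_Der_q by simp
    have "extremal H" if "mG G H = (p * q) * (p * q)"
    proof -
      have "card H = card Der" using that m p_gt_1 q_pos card_Der_q by simp
      then have "H = Der" using subgroup_eqI[OF H(1) subgroup_Der H(2)] by simp
      then show ?thesis by (simp add: extremal_def)
    qed
    then show ?thesis using m cH by simp
  next
    case 3
    then obtain c where c: "c \<in> ?D" "c \<notin> Der" by blast
    have cc: "c \<in> carrier G" using c by (simp add: centralizer_def)
    have HW: "H \<subseteq> W c" using centralizer_Der_part[OF c(1)] H(2) by blast
    have cH: "card H \<le> q"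
      using card_mono_subgroup[OF HW subgroup_W[OF cc]] card_W_le[OF cc c(2)] by simp
    have cD: "card ?D \<le> p ^ 2 * q" using card_bound_if_proper[OF D 3(1)] .
    have e: "q * (p ^ 2 * q) = (p * q) * (p * q)" by (simp add: power2_eq_square)
    have le: "mG G H \<le> (p * q) * (p * q)" unfolding mG_def e[symmetric] using cH cD by (rule mult_le_mono)
    have "extremal H" if "mG G H = (p * q) * (p * q)"
    proof -
      have "card H * card ?D = q * (p ^ 2 * q)" using that unfolding mG_def e .
      then have "card H = q" by (rule mult_le_mult_eqD(1)[OF cH cD]) (use p_gt_1 q_pos in simp)
      then have "H = W c" "card (W c) = q"
        using subgroup_eqI[OF H(1) subgroup_W[OF cc] HW] card_W_le[OF cc c(2)] by simp_all
      then have HL: "H = L 2" using W_eq_L2[OF cc] by simp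
      then show ?thesis using extremal_T[OF _ c(2)] c(1) by simp
    qed
    then show ?thesis using le by blast
  qed
qed

text \<open>For proper \<open>H\<close> with \<open>C H\<close> inside \<open>Der\<close>, the roles
  of \<open>H\<close> and \<open>C H\<close> from \<open>mG_inside_Der\<close> are exchanged. If
  neither lies in \<open>Der\<close>, an outside element of each confines the other's intersection
  with \<open>Der\<close> to q elements, so both orders are at most pq.\<close>

lemma mG_outside_Der:
  assumes H: "subgroup H G" "\<not> H \<subseteq> Der"
  shows "mG G H \<le> (p * q) * (p * q) \<and> (mG G H = (p * q) * (p * q) \<longrightarrow> extremal H)"
proof -
  let ?D = "C H"
  have D: "subgroup ?D G" using subgroup_C[OF H(1)] .
  obtain h where h: "h \<in> H" "h \<notin> Der" using H(2) by blast
  have hc: "h \<in> carrier G" using H(1) h(1) by (rule subgroup.mem_carrier)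
  have HCD: "H \<subseteq> C ?D" using le_C_C[OF H(1)] .
  consider "H = carrier G" | "H \<noteq> carrier G" "?D \<subseteq> Der" | "H \<noteq> carrier G" "\<not> ?D \<subseteq> Der" by blast
  then show ?thesis
  proof cases
    case 1
    have "mG G H = p ^ 3 * q * p" unfolding mG_def 1 using card_G_q card_Z by (simp flip: center_eq)
    then have m: "mG G H = p ^ 4 * q" by (simp add: eval_nat_numeral)
    have "extremal H" if "mG G H = (p * q) * (p * q)"
    proof -
      have "n = 5" by (rule p4q(2)) (use that m in argo)
      then show ?thesis using 1 unfolding extremal_def by blast
    qed
    then show ?thesis using m p4q(1) by simp
  next
    case 2
    have DW: "?D \<subseteq> W h" using centralizer_part[OF h(1)] 2(2) by blast
    have cD: "card ?D \<le> q"
      using card_mono_subgroup[OF DW subgroup_W[OF hc]] card_W_le[OF hc h(2)] by simp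
    have cH: "card H \<le> p ^ 2 * q" using card_bound_if_proper[OF H(1) 2(1)] .
    have e: "p ^ 2 * q * q = (p * q) * (p * q)" by (simp add: power2_eq_square)
    have le: "mG G H \<le> (p * q) * (p * q)" unfolding mG_def e[symmetric] using cH cD by (rule mult_le_mono)
    have "extremal H" if "mG G H = (p * q) * (p * q)"
    proof -
      have "card H * card ?D = p ^ 2 * q * q" using that unfolding mG_def e .
      then have c: "card H = p ^ 2 * q" "card ?D = q"
        using mult_le_mult_eqD[OF cH cD] p_gt_1 q_pos by simp_all
      then have "?D = W h" "card (W h) = q"
        using subgroup_eqI[OF D subgroup_W[OF hc] DW] card_W_le[OF hc h(2)]
          card_mono_subgroup[OF DW subgroup_W[OF hc]] by simp_all
      then have "?D = L 2" using W_eq_L2[OF hc] by simp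
      then have HT: "H \<subseteq> T" using HCD by simp
      then have hT: "h \<in> T" using h(1) by blast
      have "H = T" using subgroup_eqI[OF H(1) subgroup_T HT] c T_structure(1)[OF hT h(2)] by simp
      then show ?thesis using extremal_T[OF hT h(2)] by simp
    qed
    then show ?thesis using le by blast
  next
    case 3
    then obtain c where c: "c \<in> ?D" "c \<notin> Der" by blast
    have cc: "c \<in> carrier G" using c by (simp add: centralizer_def)
    have Dp: "?D \<noteq> carrier G" using C_carrier_imp[OF H(1)] center_subset_Der H(2) by blast
    let ?HI = "H \<inter> Der" and ?DI = "?D \<inter> Der"
    have HW: "?HI \<subseteq> W c" using centralizer_Der_part[OF c(1)] .
    have DW: "?DI \<subseteq> W h" using centralizer_part[OF h(1)] .
    have sH: "subgroup ?HI G" and sD: "subgroup ?DI G"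
      using H(1) D subgroup_Der by (simp_all add: subgroups_Inter_pair)
    have bH: "card ?HI \<le> q"
      using card_mono_subgroup[OF HW subgroup_W[OF cc]] card_W_le[OF cc c(2)] by simp
    have bD: "card ?DI \<le> q"
      using card_mono_subgroup[OF DW subgroup_W[OF hc]] card_W_le[OF hc h(2)] by simp
    have lH: "card H \<le> p * card ?HI" using card_le_if_proper[OF H(1) 3(1)] .
    have lD: "card ?D \<le> p * card ?DI" using card_le_if_proper[OF D Dp] .
    have cH: "card H \<le> p * q" using lH bH by (meson le_trans mult_le_mono2)
    have cD: "card ?D \<le> p * q" using lD bD by (meson le_trans mult_le_mono2)
    have le: "mG G H \<le> (p * q) * (p * q)" unfolding mG_def using cH cD by (rule mult_le_mono)
    have "extremal H" if "mG G H = (p * q) * (p * q)"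
    proof -
      have e: "card H = p * q" "card ?D = p * q"
        using mult_le_mult_eqD[OF cH cD] that p_gt_1 q_pos by (simp_all add: mG_def)
      \<comment> \<open>Equality forces both intersections with \<open>Der\<close> to be
        \<open>L 2\<close>. So \<open>L 2\<close> is contained in \<open>H\<close> and centralized
        by it, which places \<open>H\<close> between \<open>L 2\<close> and
        \<open>T\<close>.\<close>
      then have "q \<le> card ?HI" "q \<le> card ?DI" using lH lD p_gt_1 by simp_all
      then have "?HI = W c" "card (W c) = q" "?DI = W h" "card (W h) = q"
        using subgroup_eqI[OF sH subgroup_W[OF cc] HW] subgroup_eqI[OF sD subgroup_W[OF hc] DW]
          card_W_le[OF cc c(2)] card_W_le[OF hc h(2)] bH bD
          card_mono_subgroup[OF HW subgroup_W[OF cc]] card_mono_subgroup[OF DW subgroup_W[OF hc]]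
        by linarith+
      then have HL: "?HI = L 2" and DL: "?DI = L 2" using W_eq_L2[OF cc] W_eq_L2[OF hc] by simp_all
      have "L 2 \<subseteq> ?D" using DL by blast
      then have HT: "H \<subseteq> T" using HCD centralizer_mono by blast
      then have "H \<in> I" using H(1) HL e by (auto simp: I_def)
      then show ?thesis using extremal_T[OF _ h(2)] h(1) HT by blast
    qed
    then show ?thesis using le by blast
  qed
qed

lemma mG_le: "subgroup H G \<Longrightarrow> mG G H \<le> (p * q) * (p * q)"
  and mG_eq_imp: "subgroup H G \<Longrightarrow> mG G H = (p * q) * (p * q) \<Longrightarrow> extremal H"
  using mG_inside_Der mG_outside_Der by blast+

section \<open>Determination of the Chermak-Delgado lattice without an abelian subgroup of index
  p\<close>

lemma CD_eq: "CD G = {H. subgroup H G \<and> mG G H = (p * q) * (p * q)}"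
proof (rule CD_eqI[OF fin subgroup_Der _ mG_le])
  show "mG G Der = (p * q) * (p * q)" by (simp add: mG_def C_Der card_Der_q)
qed

lemma in_CD: "subgroup H G \<Longrightarrow> (p * q) * (p * q) \<le> mG G H \<Longrightarrow> H \<in> CD G"
  using CD_eq mG_le by (simp add: le_antisym)

lemma Der_in_CD: "Der \<in> CD G"
  using in_CD[OF subgroup_Der] by (simp add: mG_def C_Der card_Der_q)

lemma CD_extremal: "CD G \<subseteq> {H. extremal H}"
  using CD_eq mG_eq_imp by blast

lemma I_properties:
  assumes cT: "card T = p ^ 2 * q"
  shows "finite I" "card I = p + 1" "\<And>H. H \<in> I \<Longrightarrow> abelian_subgroup G H" "Der \<in> I"
proof -
  have "\<not> abelian_subgroup G T"
    using no_abelian cT pow_n_q by (auto simp: power2_eq_square mult.assoc)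
  note * = card_intermediate_subgroups[OF fin prime_p subgroup_lower_central subgroup_T
      subset_trans[OF L2_subset_Der Der_subset_T] le_C_C[OF subgroup_lower_central] this cT]
  show "finite I" "card I = p + 1" "\<And>H. H \<in> I \<Longrightarrow> abelian_subgroup G H"
    using * by (simp_all add: I_def)
  show "Der \<in> I"
    using subgroup_Der L2_subset_Der Der_subset_T card_Der_q by (simp add: I_def)
qed

text \<open>\<open>Der\<close> occupies one of the p+1 places in \<open>I\<close>; the remaining p
  are the A_1, ..., A_p of the theorem.\<close>

lemma enumerate_I:
  assumes cT: "card T = p ^ 2 * q"
  obtains A :: "nat \<Rightarrow> 'a set" where "A ` {1..p} = I - {Der}" "inj_on A {1..p}"
proof -
  have "card (I - {Der}) = p" using I_properties[OF cT] by simp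
  then obtain A where "bij_betw A {1..p} (I - {Der})"
    using ex_bij_betw_nat_finite_1[of "I - {Der}"] I_properties(1)[OF cT] by auto
  then show ?thesis using that unfolding bij_betw_def by blast
qed

lemma I_not_normal: "H \<in> I \<Longrightarrow> H \<noteq> Der \<Longrightarrow> \<not> H \<lhd> G"
  using normal_index_p2[of H] card_Der_q by (auto simp: I_def)

text \<open>By \<open>mG_le\<close> only lower bounds are needed for membership. \<open>L 2\<close>
  has centralizer \<open>T\<close>, \<open>T\<close> is centralized by \<open>L 2\<close>, and each
  member of \<open>I\<close> is abelian and so contained in its centralizer. For n = 5 the centre
  and \<open>G\<close> tie with them.\<close>

lemma CD_if_T:
  assumes cT: "card T = p ^ 2 * q"
  shows "CD G = {L 2, T} \<union> I \<union> (if n = 5 then {Z, carrier G} else {})"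
proof
  have "Der \<in> I" using I_properties(4)[OF cT] .
  then show "CD G \<subseteq> {L 2, T} \<union> I \<union> (if n = 5 then {Z, carrier G} else {})"
    using CD_extremal by (auto simp: extremal_def)
  have e: "q * (p ^ 2 * q) = (p * q) * (p * q)" by (simp add: power2_eq_square)
  have "L 2 \<in> CD G"
    by (rule in_CD[OF subgroup_lower_central]) (simp only: mG_def cT e le_refl)
  moreover have "T \<in> CD G"
  proof (rule in_CD[OF subgroup_T])
    have "q \<le> card (C T)"
      by (rule card_mono_subgroup[OF le_C_C[OF subgroup_lower_central] subgroup_C[OF subgroup_T]])
    then show "(p * q) * (p * q) \<le> mG G T"
      unfolding mG_def cT e[symmetric] by (simp add: mult.commute)
  qed
  moreover have "H \<in> CD G" if H: "H \<in> I" for H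
  proof (rule in_CD)
    show s: "subgroup H G" using H by (simp add: I_def)
    have "H \<subseteq> C H" using I_properties(3)[OF cT H] by (simp add: abelian_subgroup_iff)
    then have "card H \<le> card (C H)" by (rule card_mono_subgroup[OF _ subgroup_C[OF s]])
    moreover have "card H = p * q" using H by (simp add: I_def)
    ultimately show "(p * q) * (p * q) \<le> mG G H" unfolding mG_def by (metis mult_le_mono2)
  qed
  moreover have "Z \<in> CD G" "carrier G \<in> CD G" if n: "n = 5"
  proof -
    have q: "q = p ^ 2" using n q_eq_iff by blast
    have e: "p * (p ^ 3 * q) = (p * q) * (p * q)" unfolding q by (simp add: eval_nat_numeral)
    have "C Z = carrier G" by (auto simp: center_iff centralizer_def)
    then have "mG G Z = p * (p ^ 3 * q)" unfolding mG_def using card_Z card_G_q by simp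
    then show "Z \<in> CD G" using in_CD[OF subgroup_center] e by simp
    have "mG G (carrier G) = (p ^ 3 * q) * p"
      unfolding mG_def center_eq[symmetric] card_Z card_G_q ..
    then show "carrier G \<in> CD G" using in_CD[OF subgroup_self] e by (simp add: mult.commute)
  qed
  ultimately show "{L 2, T} \<union> I \<union> (if n = 5 then {Z, carrier G} else {}) \<subseteq> CD G" by auto
qed

text \<open>The index p subgroup given in the theorem can only be the centralizer of
  \<open>L 2\<close>: for \<open>h\<close> in \<open>S\<close> outside \<open>Der\<close>, the
  centre of \<open>S\<close> lies in \<open>W h\<close> and has the maximal size q, so it is
  \<open>L 2\<close>, and \<open>S\<close> centralizes it.\<close>

lemma T_unique:
  assumes S: "subgroup S G" "p ^ n = p * card S" "card S = p ^ 2 * card (grp_center G S)"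
  shows "S = T" "card T = p ^ 2 * q" "grp_center G T = L 2"
proof -
  have cS: "card S = p ^ 2 * q" using S(2) pow_n_q p_gt_1 by (simp add: power2_eq_square mult.assoc)
  have cz: "card (grp_center G S) = q" using S(3) unfolding cS using p_gt_1 by simp
  have DS: "Der \<subseteq> S" using index_p_contains_Der[OF S(1,2)] .
  have "card Der < card S" using cS card_Der_q p_gt_1 q_pos by (simp add: power2_eq_square)
  then have "S \<noteq> Der" by auto
  then obtain h where h: "h \<in> S" "h \<notin> Der" using DS by blast
  have hc: "h \<in> carrier G" using S(1) h(1) by (rule subgroup.mem_carrier)
  have "grp_center G S \<subseteq> W h"
    using centralizer_mono[OF DS] C_Der centralizer_mono[of "{h}" S] h by (auto simp: grp_center_def)
  moreover have "subgroup (grp_center G S) G"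
    unfolding grp_center_def using S(1) subgroup_C by (simp add: subgroups_Inter_pair)
  ultimately have Zh: "grp_center G S = W h"
    using subgroup_eqI[OF _ subgroup_W[OF hc]] card_W_le[OF hc h(2)] cz by simp
  then have "grp_center G S = L 2" using W_eq_L2[OF hc] cz by simp
  then have "L 2 \<subseteq> C S" by (auto simp: grp_center_def)
  then have ST: "S \<subseteq> T" using centralizer_sym[OF lower_central_subset subgroup.subset[OF S(1)]] by blast
  then have hT: "h \<in> T" using h by blast
  show "card T = p ^ 2 * q" "grp_center G T = L 2" using T_structure[OF hT h(2)] by simp_all
  then show "S = T" using subgroup_eqI[OF S(1) subgroup_T ST] cS by simp
qed

lemma CD_if_no_T:
  assumes "n > 5"
    and no: "\<not> (\<exists>S. subgroup S G \<and> p ^ n = p * card S \<and> card S = p ^ 2 * card (grp_center G S))"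
  shows "CD G = {Der}"
proof -
  have "\<not> (card T = p ^ 2 * q \<and> grp_center G T = L 2)"
  proof
    assume T: "card T = p ^ 2 * q \<and> grp_center G T = L 2"
    then have "p ^ n = p * card T" unfolding pow_n_q by (simp add: power2_eq_square mult.assoc)
    moreover have "card T = p ^ 2 * card (grp_center G T)" using T by simp
    ultimately show False using no subgroup_T by blast
  qed
  then have "CD G \<subseteq> {Der}" using CD_extremal assms(1) by (auto simp: extremal_def)
  then show ?thesis using Der_in_CD by blast
qed

text \<open>For n = 5 the index n-3 is 2, so \<open>card_centralizer_L\<close> speaks of
  \<open>T\<close> itself: its index is at most p, while \<open>Der\<close> has index p^2.\<close>

lemma order_p5:
  assumes n: "n = 5"
  shows "card T = p ^ 2 * q" "grp_center G T = L 2"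
proof -
  have "n - 3 = 2" "n \<ge> 4" using n by simp_all
  then have "p ^ n \<le> p * card T" using card_centralizer_L by metis
  then have "p * (p * q) \<le> card T" unfolding pow_n_q using p_gt_1 by simp
  moreover have "p * q < p * (p * q)" using p_gt_1 q_pos by simp
  ultimately have "card Der < card T" unfolding card_Der_q by linarith
  then have "T \<noteq> Der" by auto
  then obtain h where h: "h \<in> T" "h \<notin> Der" using Der_subset_T by blast
  show "card T = p ^ 2 * q" "grp_center G T = L 2" using T_structure(1,2)[OF h] by simp_all
qed

end

theorem theorem4p1:
  fixes G :: "('a, 'b) monoid_scheme" and p n :: nat
  assumes grp: "maximal_class_pgroup G p n"
    and meta: "metabelian G"
  shows
   "(n = 3 \<longrightarrow>
      (\<exists>A :: nat \<Rightarrow> 'a set.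
         (\<forall>i \<in> {0..p}. abelian_subgroup G (A i)) \<and> inj_on A {0..p} \<and>
         CD G = {grp_center G (carrier G), carrier G} \<union> A ` {0..p} \<and>
         quasi_antichain (CD G) (p + 1)))
  \<and> (\<forall>A. abelian_subgroup G A \<and> order G = p * card A \<and> n > 3 \<longrightarrow>
      CD G = {A})
  \<and> (\<not> (\<exists>A. abelian_subgroup G A \<and> order G = p * card A) \<longrightarrow>
      n > 4
    \<and> (order G = p ^ 5 \<longrightarrow>
        (\<exists>T (A :: nat \<Rightarrow> 'a set).
           subgroup T G \<and> card T = p ^ 4 \<and>
           card (derived G (carrier G)) = p ^ 3 \<and>
           card (grp_center G T) = p ^ 2 \<and>
           (\<forall>i \<in> {1..p}. subgroup (A i) G \<and> card (A i) = p ^ 3 \<and>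
               abelian_subgroup G (A i) \<and> A i \<noteq> derived G (carrier G) \<and>
               \<not> A i \<lhd> G) \<and>
           abelian_subgroup G (derived G (carrier G)) \<and>
           inj_on A {1..p} \<and>
           CD G = {grp_center G (carrier G), grp_center G T, derived G (carrier G), T, carrier G}
                  \<union> A ` {1..p}))
    \<and> (\<forall>T. order G > p ^ 5 \<and> subgroup T G \<and> order G = p * card T \<and>
           card T = p ^ 2 * card (grp_center G T) \<longrightarrow>
        (\<exists>A :: nat \<Rightarrow> 'a set.
           card T = p ^ (n - 1) \<and>
           card (derived G (carrier G)) = p ^ (n - 2) \<and>
           card (grp_center G T) = p ^ (n - 3) \<and>
           (\<forall>i \<in> {1..p}. subgroup (A i) G \<and> card (A i) = p ^ (n - 2) \<and>
               abelian_subgroup G (A i) \<and> A i \<noteq> derived G (carrier G) \<and>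
               \<not> A i \<lhd> G) \<and>
           abelian_subgroup G (derived G (carrier G)) \<and>
           inj_on A {1..p} \<and>
           CD G = {grp_center G T, derived G (carrier G), T} \<union> A ` {1..p}))
    \<and> (order G > p ^ 5 \<and>
       \<not> (\<exists>T. subgroup T G \<and> order G = p * card T \<and>
              card T = p ^ 2 * card (grp_center G T)) \<longrightarrow>
        CD G = {derived G (carrier G)}))"
proof -
  interpret Group.group G using grp by (simp add: maximal_class_pgroup_def)
  interpret maximal_class G p n by unfold_locales (rule grp)
  have Dab: "abelian_subgroup G Der" using meta by (simp add: metabelian_def)
  have ord: "order G = p ^ n" using card_G by (simp add: order_def)
  have gt5: "order G > p ^ 5 \<longleftrightarrow> n > 5" unfolding ord using p_gt_1 by simp
  have eq5: "order G = p ^ 5 \<longleftrightarrow> n = 5" unfolding ord using p_gt_1 by simp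
  have order3: "\<exists>A :: nat \<Rightarrow> 'a set.
         (\<forall>i \<in> {0..p}. abelian_subgroup G (A i)) \<and> inj_on A {0..p} \<and>
         CD G = {Z, carrier G} \<union> A ` {0..p} \<and> quasi_antichain (CD G) (p + 1)" if n: "n = 3"
  proof -
    let ?I = "{H. subgroup H G \<and> Z \<subseteq> H \<and> H \<subseteq> carrier G \<and> card H = p * card Z}"
    have cZ: "card Z = p" using card_center n by simp
    have cG: "card (carrier G) = p ^ 2 * card Z"
      using card_G n cZ by (simp add: power2_eq_square power3_eq_cube)
    have ZC: "Z \<subseteq> C (carrier G)" by (simp flip: center_eq)
    have "\<not> abelian_subgroup G (carrier G)" using not_abelian n by simp
    note I = card_intermediate_subgroups[OF fin prime_p subgroup_center subgroup_self
        subgroup.subset[OF subgroup_center] ZC this cG]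
    have CDI: "CD G = {Z, carrier G} \<union> ?I" using CD_order_p3[OF n] .
    obtain f where "bij_betw f {0..<card ?I} ?I" using ex_bij_betw_nat_finite[OF I(1)] by blast
    then have "bij_betw f {0..p} ?I" using I(2) by (simp add: atLeastLessThanSuc_atLeastAtMost)
    then have f: "inj_on f {0..p}" "f ` {0..p} = ?I" by (simp_all add: bij_betw_def)
    have p0: "p > 1" by (rule p_gt_1)
    have "quasi_antichain (CD G) (p + 1)"
      unfolding quasi_antichain_def
    proof (intro exI conjI)
      show "CD G = {Z, carrier G} \<union> ?I" by (rule CDI)
      have "p ^ 2 > 1" by (rule one_less_power[OF p0]) simp
      then have "card Z \<noteq> card (carrier G)" unfolding cG cZ using p0 by simp
      then show "Z \<noteq> carrier G" by auto
      show "Z \<notin> ?I" using cZ p0 by simp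
      show "carrier G \<notin> ?I" using cG cZ p0 by (simp add: power2_eq_square)
      show "finite ?I" "card ?I = p + 1" using I(1,2) .
      show "\<forall>S1. S1 \<in> CD G \<longrightarrow> Z \<subseteq> S1 \<and> S1 \<subseteq> carrier G"
        unfolding CDI using subgroup.subset[OF subgroup_center] by auto
      show "\<forall>S1 S2. S1 \<in> ?I \<and> S2 \<in> ?I \<and> S1 \<subseteq> S2 \<longrightarrow> S1 = S2"
        using subgroup_eqI by auto
    qed
    moreover have "abelian_subgroup G (f i)" if "i \<in> {0..p}" for i
    proof (rule I(3))
      show "f i \<in> ?I" unfolding f(2)[symmetric] using that by (rule imageI)
    qed
    moreover have "CD G = {Z, carrier G} \<union> f ` {0..p}" unfolding f(2) by (rule CDI)
    ultimately show ?thesis using f(1) by (intro exI[of _ f] conjI ballI)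
  qed
  \<comment> \<open>The last part of the theorem with conditions on the order of \<open>G\<close>
    turned into conditions on \<open>n\<close>, the form in which the locale results are
    available.\<close>
  have no_abelian_case: "n > 4 \<and>
      (n = 5 \<longrightarrow>
        (\<exists>T (A :: nat \<Rightarrow> 'a set).
           subgroup T G \<and> card T = p ^ 4 \<and>
           card Der = p ^ 3 \<and>
           card (grp_center G T) = p ^ 2 \<and>
           (\<forall>i \<in> {1..p}. subgroup (A i) G \<and> card (A i) = p ^ 3 \<and>
               abelian_subgroup G (A i) \<and> A i \<noteq> Der \<and>
               \<not> A i \<lhd> G) \<and>
           abelian_subgroup G Der \<and>
           inj_on A {1..p} \<and>
           CD G = {Z, grp_center G T, Der, T, carrier G} \<union> A ` {1..p}))
    \<and> (\<forall>T. n > 5 \<and> subgroup T G \<and> p ^ n = p * card T \<and>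
           card T = p ^ 2 * card (grp_center G T) \<longrightarrow>
        (\<exists>A :: nat \<Rightarrow> 'a set.
           card T = p ^ (n - 1) \<and>
           card Der = p ^ (n - 2) \<and>
           card (grp_center G T) = p ^ (n - 3) \<and>
           (\<forall>i \<in> {1..p}. subgroup (A i) G \<and> card (A i) = p ^ (n - 2) \<and>
               abelian_subgroup G (A i) \<and> A i \<noteq> Der \<and>
               \<not> A i \<lhd> G) \<and>
           abelian_subgroup G Der \<and>
           inj_on A {1..p} \<and>
           CD G = {grp_center G T, Der, T} \<union> A ` {1..p}))
    \<and> (n > 5 \<and>
       \<not> (\<exists>T. subgroup T G \<and> p ^ n = p * card T \<and>
              card T = p ^ 2 * card (grp_center G T)) \<longrightarrow>
        CD G = {Der})"
    if no: "\<not> (\<exists>A. abelian_subgroup G A \<and> p ^ n = p * card A)"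
  proof -
    interpret no_abelian_index_p G p n by unfold_locales (use Dab no in auto)
    let ?T = "C (L 2)" and ?q = "card (L 2)"
    have pw: "p * ?q = p ^ (n - 2)" "p ^ 2 * ?q = p ^ (n - 1)"
      using pow_split[of 1 "n - 2"] pow_split[of 2 "n - 1"] n_ge_5 unfolding q_eq
      by (simp_all add: numeral_2_eq_2 numeral_3_eq_3)
    have sub: "subgroup H G \<and> card H = p ^ (n - 2) \<and> abelian_subgroup G H \<and> H \<noteq> Der \<and> \<not> H \<lhd> G"
      if cT: "card ?T = p ^ 2 * ?q" and H: "H \<in> I - {Der}" for H
    proof -
      have "H \<in> I" "H \<noteq> Der" using H by auto
      then show ?thesis using I_properties(3)[OF cT] I_not_normal[of H] pw by (simp add: I_def)
    qed
    have A5: "\<exists>T (A :: nat \<Rightarrow> 'a set).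
           subgroup T G \<and> card T = p ^ 4 \<and>
           card Der = p ^ 3 \<and>
           card (grp_center G T) = p ^ 2 \<and>
           (\<forall>i \<in> {1..p}. subgroup (A i) G \<and> card (A i) = p ^ 3 \<and>
               abelian_subgroup G (A i) \<and> A i \<noteq> Der \<and>
               \<not> A i \<lhd> G) \<and>
           abelian_subgroup G Der \<and>
           inj_on A {1..p} \<and>
           CD G = {Z, grp_center G T, Der, T, carrier G} \<union> A ` {1..p}" if n: "n = 5"
    proof -
      note T5 = order_p5[OF n]
      obtain A :: "nat \<Rightarrow> 'a set" where A: "A ` {1..p} = I - {Der}" "inj_on A {1..p}"
        using enumerate_I[OF T5(1)] .
      have "CD G = {L 2, ?T} \<union> I \<union> {Z, carrier G}" using CD_if_T[OF T5(1)] n by auto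
      also have "\<dots> = {Z, grp_center G ?T, Der, ?T, carrier G} \<union> A ` {1..p}"
        unfolding A(1) T5(2) using I_properties(4)[OF T5(1)] by auto
      finally have CDA: "CD G = {Z, grp_center G ?T, Der, ?T, carrier G} \<union> A ` {1..p}" .
      have q2: "?q = p ^ 2" using q_eq_iff n by blast
      have e: "n - 2 = 3" "n - 1 = 4" using n by simp_all
      have cT: "card ?T = p ^ 4" using T5(1) pw(2) unfolding e by metis
      have cD: "card Der = p ^ 3" using card_Der_q pw(1) unfolding e by metis
      have cZT: "card (grp_center G ?T) = p ^ 2" unfolding T5(2) by (rule q2)
      have Ai: "\<forall>i\<in>{1..p}. subgroup (A i) G \<and> card (A i) = p ^ 3 \<and> abelian_subgroup G (A i) \<and> A i \<noteq> Der \<and> \<not> A i \<lhd> G"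
      proof (rule ballI)
        fix i assume "i \<in> {1..p}"
        then have "A i \<in> I - {Der}" unfolding A(1)[symmetric] by (rule imageI)
        from sub[OF T5(1) this] show "subgroup (A i) G \<and> card (A i) = p ^ 3 \<and> abelian_subgroup G (A i) \<and> A i \<noteq> Der \<and> \<not> A i \<lhd> G"
          unfolding e .
      qed
      show ?thesis
        by (rule exI[of _ ?T], rule exI[of _ A], intro conjI subgroup_T cT cD cZT Ai Dab A(2) CDA)
    qed
    have B: "\<exists>A :: nat \<Rightarrow> 'a set.
           card T = p ^ (n - 1) \<and>
           card Der = p ^ (n - 2) \<and>
           card (grp_center G T) = p ^ (n - 3) \<and>
           (\<forall>i \<in> {1..p}. subgroup (A i) G \<and> card (A i) = p ^ (n - 2) \<and>
               abelian_subgroup G (A i) \<and> A i \<noteq> Der \<and>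
               \<not> A i \<lhd> G) \<and>
           abelian_subgroup G Der \<and>
           inj_on A {1..p} \<and>
           CD G = {grp_center G T, Der, T} \<union> A ` {1..p}"
      if n: "n > 5" and T: "subgroup T G" "p ^ n = p * card T" "card T = p ^ 2 * card (grp_center G T)" for T
    proof -
      note U = T_unique[OF T]
      obtain A :: "nat \<Rightarrow> 'a set" where A: "A ` {1..p} = I - {Der}" "inj_on A {1..p}"
        using enumerate_I[OF U(2)] .
      have "CD G = {L 2, ?T} \<union> I" using CD_if_T[OF U(2)] n by auto
      also have "\<dots> = {grp_center G ?T, Der, ?T} \<union> A ` {1..p}"
        unfolding A(1) U(3) using I_properties(4)[OF U(2)] by auto
      finally have CDA: "CD G = {grp_center G T, Der, T} \<union> A ` {1..p}" unfolding U(1) .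
      have cT: "card T = p ^ (n - 1)" unfolding U(1) using U(2) pw(2) by metis
      have cD: "card Der = p ^ (n - 2)" using card_Der_q pw(1) by metis
      have cZT: "card (grp_center G T) = p ^ (n - 3)" unfolding U(1,3) by (rule q_eq)
      have Ai: "\<forall>i\<in>{1..p}. subgroup (A i) G \<and> card (A i) = p ^ (n - 2) \<and> abelian_subgroup G (A i) \<and> A i \<noteq> Der \<and> \<not> A i \<lhd> G"
      proof (rule ballI)
        fix i assume "i \<in> {1..p}"
        then have "A i \<in> I - {Der}" unfolding A(1)[symmetric] by (rule imageI)
        then show "subgroup (A i) G \<and> card (A i) = p ^ (n - 2) \<and> abelian_subgroup G (A i) \<and> A i \<noteq> Der \<and> \<not> A i \<lhd> G"
          by (rule sub[OF U(2)])
      qed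
      show ?thesis
        by (rule exI[of _ A], intro conjI cT cD cZT Ai Dab A(2) CDA)
    qed
    have n4: "n > 4" using n_ge_5 by simp
    show ?thesis
    proof (intro conjI[OF n4] conjI[OF impI[OF A5]] conjI[OF allI[OF impI]] impI)
      show "CD G = {Der}" if "n > 5 \<and> \<not> (\<exists>T. subgroup T G \<and> p ^ n = p * card T \<and>
              card T = p ^ 2 * card (grp_center G T))"
        using that by (intro CD_if_no_T) auto
    qed (assumption, elim conjE, rule B)
  qed
  show ?thesis
    unfolding gt5 eq5 unfolding ord
  proof (intro conjI[OF impI conjI[OF allI[OF impI] impI]])
    show "CD G = {A}" if "abelian_subgroup G A \<and> p ^ n = p * card A \<and> n > 3" for A
      using that CD_abelian_index_p by blast
  qed (erule order3, erule no_abelian_case)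
qed

end
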